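(* Let $L\colon[a,b]\times\mathbb{R}^n\times\mathbb{R}^n\to\mathbb{R}$ be continuous and satisfy the strict convexity condition (SC) stated in the context. Let $v=(v_1,\dots,v_n)\in W^{1,1}((a,b);\mathbb{R}^n)$ be a minimizer of $\mathscr{L}$ over $\mathscr{A}_{v(a),v(b)}$, and suppose that $t\in(a,b)$ is such that $D^-v(t)$ and $D^+v(t)$ both exist (with components finite or infinite), and $v_j$ is Lipschitz in a neighbourhood of $t$ for each $2\le j\le n$. Then if one of the one-sided derivatives $D^-v_1(t)$, $D^+v_1(t)$ is infinite, then $D^-v_1(t)$ and $D^+v_1(t)$ are equal to the same infinite value.
   Context: $[a,b]\subseteq\mathbb{R}$, $n\ge1$, $\|\cdot\|$ is the Euclidean norm on $\mathbb{R}^n$. Functions in $W^{1,1}((a,b);\mathbb{R}^n)$ are identified with their absolutely continuous representatives on $[a,b]$. $\mathscr{L}(u)=\int_a^bL(t,u(t),u'(t))\,dt$; $\mathscr{A}_{A,B}=\{u\in W^{1,1}((a,b);\mathbb{R}^n):u(a)=A,\ u(b)=B\}$; a minimizer of $\mathscr{L}$ over $\mathscr{A}_{v(a),v(b)}$ is $v$ with $\mathscr{L}(v)\le\mathscr{L}(u)$ for all $u\in\mathscr{A}_{v(a),v(b)}$. Condition (SC): for all $R\in[1,\infty)$ there exists $\tau_R>0$ such that for all $(t,y,p)\in[a,b]\times\mathbb{R}^n\times\mathbb{R}^n$ with $\max\{|t|,\|y\|,\|p\|\}\le R+1$ there exists a subdifferential (subgradient) $\xi\in\mathbb{R}^n$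 of $L(t,y,\cdot)$ at $p$ (i.e. $L(t,y,q)\ge L(t,y,p)+\xi\cdot(q-p)$ for all $q\in\mathbb{R}^n$) such that $L(t,y,q)\ge L(t,y,p)+\xi\cdot(q-p)+2\tau_R$ whenever $\|q-p\|\ge R^{-1}$. One-sided derivatives: for scalar $v$, $D^-v(t)=\lim_{s\uparrow t}\frac{v(s)-v(t)}{s-t}$ and $D^+v(t)=\lim_{s\downarrow t}\frac{v(s)-v(t)}{s-t}$, whenever these limits make sense and exist as finite or infinite values; for vector-valued $v$ they are formed componentwise and exist iff they exist (as finite or infinite values) for each component. *)

theory Defs
  imports "HOL-Analysis.Analysis"
begin

definition ac_on_interval :: "real \<Rightarrow> real \<Rightarrow> (real \<Rightarrow> 'v::real_normed_vector) \<Rightarrow> bool" where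
  "ac_on_interval a b u \<longleftrightarrow>
     (\<forall>\<epsilon>>0. \<exists>\<delta>>0. \<forall>D S. D division_of S \<longrightarrow> S \<subseteq> {a..b} \<longrightarrow> (\<Sum>K\<in>D. Sup K - Inf K) < \<delta> \<longrightarrow>
        (\<Sum>K\<in>D. norm (u (Sup K) - u (Inf K))) < \<epsilon>)"

text \<open>Smooth functions with compact support in the open interval \<open>(a, b)\<close>.\<close>

definition test_function :: "real \<Rightarrow> real \<Rightarrow> (real \<Rightarrow> real) \<Rightarrow> bool" where
  "test_function a b \<phi> \<longleftrightarrow>
     (\<forall>k x. (deriv ^^ k) \<phi> field_differentiable at x) \<and>
     (\<exists>c d. a < c \<and> d < b \<and> (\<forall>x. x \<notin> {c..d} \<longrightarrow> \<phi> x = 0))"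

definition has_weak_derivative ::
    "real \<Rightarrow> real \<Rightarrow> (real \<Rightarrow> 'v::euclidean_space) \<Rightarrow> (real \<Rightarrow> 'v) \<Rightarrow> bool" where
  "has_weak_derivative a b u g \<longleftrightarrow>
     set_integrable lebesgue {a<..<b} g \<and>
     (\<forall>\<phi>. test_function a b \<phi> \<longrightarrow>
        (LINT x:{a<..<b}|lebesgue. deriv \<phi> x *\<^sub>R u x) = - (LINT x:{a<..<b}|lebesgue. \<phi> x *\<^sub>R g x))"

text \<open>
  Elements of \<open>W\<^sup>1\<^sup>,\<^sup>1((a, b))\<close> are identified with their absolutely continuous
  representatives on \<open>[a, b]\<close>, so equality of functions below is pointwise and boundary values make
  sense. The values outside \<open>[a, b]\<close> are irrelevant.
\<close>

definition W11 :: "real \<Rightarrow> real \<Rightarrow> (real \<Rightarrow> 'v::euclidean_space) set" where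
  "W11 a b = {u. ac_on_interval a b u \<and> set_integrable lebesgue {a<..<b} u \<and>
                 (\<exists>g. has_weak_derivative a b u g)}"

text \<open>The weak derivative, which is unique only up to null sets in \<open>(a, b)\<close>.\<close>

definition weak_derivative ::
    "real \<Rightarrow> real \<Rightarrow> (real \<Rightarrow> 'v::euclidean_space) \<Rightarrow> real \<Rightarrow> 'v" where
  "weak_derivative a b u = (SOME g. has_weak_derivative a b u g)"

text \<open>
  The integral \<open>\<integral>\<^sub>a\<^sup>b L(t, u(t), u'(t)) dt\<close> as an extended real, namely the integral of the
  positive part minus that of the negative part (\<^const>\<open>ennreal\<close> maps negative reals to \<open>0\<close>).
  If \<open>L\<close> is continuous and convex in its last argument, then the negative part has a finite integral
  for every \<open>u\<close> in \<open>W\<^sup>1\<^sup>,\<^sup>1\<close>, but the value may be \<open>\<infinity>\<close>.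
\<close>

definition action ::
    "real \<Rightarrow> real \<Rightarrow> (real \<Rightarrow> 'v::euclidean_space \<Rightarrow> 'v \<Rightarrow> real) \<Rightarrow> (real \<Rightarrow> 'v) \<Rightarrow> ereal" where
  "action a b L u =
     enn2ereal (\<integral>\<^sup>+ t\<in>{a..b}. ennreal (L t (u t) (weak_derivative a b u t)) \<partial>lebesgue) -
     enn2ereal (\<integral>\<^sup>+ t\<in>{a..b}. ennreal (- L t (u t) (weak_derivative a b u t)) \<partial>lebesgue)"

definition admissible :: "real \<Rightarrow> real \<Rightarrow> 'v \<Rightarrow> 'v \<Rightarrow> (real \<Rightarrow> 'v::euclidean_space) set" where
  "admissible a b A B = {u \<in> W11 a b. u a = A \<and> u b = B}"

definition is_minimizer ::
    "real \<Rightarrow> real \<Rightarrow> (real \<Rightarrow> 'v::euclidean_space \<Rightarrow> 'v \<Rightarrow> real) \<Rightarrow> (real \<Rightarrow> 'v) \<Rightarrow> bool" where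
  "is_minimizer a b L v \<longleftrightarrow>
     v \<in> admissible a b (v a) (v b) \<and>
     (\<forall>u \<in> admissible a b (v a) (v b). action a b L v \<le> action a b L u)"

definition is_subgradient :: "('v::real_inner \<Rightarrow> real) \<Rightarrow> 'v \<Rightarrow> 'v \<Rightarrow> bool" where
  "is_subgradient f p \<xi> \<longleftrightarrow> (\<forall>q. f q \<ge> f p + \<xi> \<bullet> (q - p))"

definition condition_SC ::
    "real \<Rightarrow> real \<Rightarrow> (real \<Rightarrow> 'v::euclidean_space \<Rightarrow> 'v \<Rightarrow> real) \<Rightarrow> bool" where
  "condition_SC a b L \<longleftrightarrow>
     (\<forall>R\<ge>1. \<exists>\<tau>>0. \<forall>t\<in>{a..b}. \<forall>y p.
        Max {\<bar>t\<bar>, norm y, norm p} \<le> R + 1 \<longrightarrow>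
        (\<exists>\<xi>. is_subgradient (L t y) p \<xi> \<and>
             (\<forall>q. norm (q - p) \<ge> inverse R \<longrightarrow> L t y q \<ge> L t y p + \<xi> \<bullet> (q - p) + 2 * \<tau>)))"

text \<open>
  One-sided derivatives with finite or infinite values; the vector-valued versions are
  componentwise.
\<close>

definition has_left_derivative :: "(real \<Rightarrow> real) \<Rightarrow> ereal \<Rightarrow> real \<Rightarrow> bool" where
  "has_left_derivative f d t \<longleftrightarrow> ((\<lambda>s. ereal ((f s - f t) / (s - t))) \<longlongrightarrow> d) (at_left t)"

definition has_right_derivative :: "(real \<Rightarrow> real) \<Rightarrow> ereal \<Rightarrow> real \<Rightarrow> bool" where
  "has_right_derivative f d t \<longleftrightarrow> ((\<lambda>s. ereal ((f s - f t) / (s - t))) \<longlongrightarrow> d) (at_right t)"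

definition has_left_derivative_vec :: "(real \<Rightarrow> real ^ 'n) \<Rightarrow> ereal ^ 'n \<Rightarrow> real \<Rightarrow> bool" where
  "has_left_derivative_vec v d t \<longleftrightarrow> (\<forall>j. has_left_derivative (\<lambda>s. v s $ j) (d $ j) t)"

definition has_right_derivative_vec :: "(real \<Rightarrow> real ^ 'n) \<Rightarrow> ereal ^ 'n \<Rightarrow> real \<Rightarrow> bool" where
  "has_right_derivative_vec v d t \<longleftrightarrow> (\<forall>j. has_right_derivative (\<lambda>s. v s $ j) (d $ j) t)"

end

theory Submission
  imports Defs
begin

text \<open>
The obstruction to a corner with a vertical side is that such a corner can be cut profitably. Fix
points \<open>x < t < y\<close> close to \<open>t\<close>, let \<open>q\<close> be the slope of the chord of \<open>v\<close> from \<open>x\<close> to \<open>y\<close>, and compare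
\<open>v\<close> with the function that follows the chord on \<open>[x, y]\<close> and agrees with \<open>v\<close> elsewhere. Condition (SC)
at \<open>(t, v t, q)\<close> provides a subgradient \<open>\<xi>\<close> and a gap \<open>\<tau>\<close>. By uniform continuity and by convexity along
rays from \<open>q\<close>, the gap persists in linear form at all nearby \<open>(s, y)\<close> and for all \<open>p\<close>, with the same \<open>\<xi>\<close>:
\<open>L s y p \<ge> L t (v t) q + \<xi> \<bullet> (p - q) + \<tau> * (norm (p - q) - 1) - \<tau> / 4\<close>
(\<open>condition_SC_growth_near_point\<close>). No growth of \<open>L\<close> at infinity beyond this is available, and
\<open>v'\<close> may be large, so it matters that \<open>\<xi>\<close> does not depend on \<open>s\<close>: then the linear term integrates to
exactly zero, as \<open>q\<close> is the mean of \<open>v'\<close> over \<open>[x, y]\<close>. The remaining term is controlled from below by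
twice the distance of \<open>v t\<close> from the chord. As the chord cannot have smaller action, this distance
is at most \<open>y - x\<close>. Since \<open>\<tau>\<close> is uniform for bounded \<open>q\<close>, the conclusion holds for all short chords whose
slopes are bounded by a given constant (\<open>minimizer_near_chords\<close>).

This property passes to the component \<open>v $ i\<close>, because the Lipschitz components contribute a bounded
amount to the slope. The rest is elementary. Suppose that a real function has right derivative
\<open>+\<infinity>\<close> at \<open>t\<close> while its left difference quotients stay below \<open>m\<close>. The line of slope \<open>m + 4\<close> through a point
just left of \<open>t\<close> passes above the corner and, by the intermediate value theorem, meets the graph again
just right of \<open>t\<close>. Its height above the corner exceeds the horizontal distance of the two points, a
contradiction (\<open>left_steep_if_right_steep\<close>). Reflecting the graph covers the other signs and sides.

Much of the text below makes the comparison legitimate for weak derivatives. Smooth cutoff functions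
turn the weak definition into integration by parts on a subinterval (\<open>weak_derivative_by_parts\<close>).
Hence the integral of a weak derivative is the increment of the function, weak derivatives are
unique almost everywhere, and the competitor with the corner cut off is again admissible.
\<close>

section \<open>Smooth functions and a smooth step\<close>

definition smooth :: "(real \<Rightarrow> real) \<Rightarrow> bool" where
  "smooth f \<longleftrightarrow> (\<forall>k x. (deriv ^^ k) f field_differentiable at x)"

lemma smooth_DERIV: "smooth f \<Longrightarrow> (f has_field_derivative deriv f x) (at x)"
  unfolding smooth_def by (metis DERIV_deriv_iff_field_differentiable funpow_0)

lemma smooth_deriv: "smooth f \<Longrightarrow> smooth (deriv f)"
  unfolding smooth_def by (metis comp_apply funpow_Suc_right)

text \<open>
This reduces smoothness to one differentiation: all iterated derivatives stay in \<open>S\<close>.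
\<close>

lemma smooth_coinduct:
  assumes "f \<in> S"
    and closed: "\<And>f. f \<in> S \<Longrightarrow> \<exists>g\<in>S. \<forall>x. (f has_field_derivative g x) (at x)"
  shows "smooth f"
proof -
  have "(deriv ^^ k) f \<in> S" for k
  proof (induction k)
    case (Suc k)
    then obtain g where "g \<in> S" and "\<And>x. ((deriv ^^ k) f has_field_derivative g x) (at x)"
      using closed by blast
    moreover from this have "deriv ((deriv ^^ k) f) = g"
      by (intro ext DERIV_imp_deriv)
    ultimately show ?case by simp
  qed (simp add: assms)
  then show ?thesis
    unfolding smooth_def using closed field_differentiable_def by blast
qed

text \<open>
The extra index \<open>k\<close> makes the family closed under differentiation up to linear combinations. The member with
\<open>k = 0\<close> is the classical smooth function that is flat at the origin.
\<close>

definition flat :: "nat \<Rightarrow> real \<Rightarrow> real" where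
  "flat k x = (if x \<le> 0 then 0 else inverse x ^ k * exp (- inverse x))"

lemma flat_tendsto_0: "(flat k \<longlongrightarrow> 0) (at 0)"
proof -
  have "((\<lambda>x::real. inverse x ^ k / exp (inverse x)) \<longlongrightarrow> 0) (at_right 0)"
    by (rule filterlim_compose[OF tendsto_power_div_exp_0 filterlim_inverse_at_top_right])
  then have "(flat k \<longlongrightarrow> 0) (at_right 0)"
  proof (rule Lim_transform_eventually)
    show "\<forall>\<^sub>F x in at_right 0. inverse x ^ k / exp (inverse x) = flat k x"
      unfolding eventually_at_filter
      by (intro always_eventually) (auto simp: flat_def exp_minus field_simps)
  qed
  moreover have "(flat k \<longlongrightarrow> 0) (at_left 0)"
  proof (rule Lim_transform_eventually[OF tendsto_const[of 0]])
    show "\<forall>\<^sub>F x in at_left 0. 0 = flat k x"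
      unfolding eventually_at_filter
      by (intro always_eventually) (auto simp: flat_def)
  qed
  ultimately show ?thesis by (simp add: filterlim_split_at)
qed

lemma flat_DERIV: "(flat k has_field_derivative (flat (k + 2) x - real k * flat (k + 1) x)) (at x)"
proof -
  consider "x < 0" | "x = 0" | "x > 0" by linarith
  then show ?thesis
  proof cases
    case 1
    have "((\<lambda>x. 0) has_field_derivative 0) (at x)" by simp
    then have "(flat k has_field_derivative 0) (at x)"
      by (rule has_field_derivative_transform_within_open[where S = "{..<0}"])
        (use 1 in \<open>auto simp: flat_def\<close>)
    then show ?thesis using 1 by (simp add: flat_def)
  next
    case 2
    have "((\<lambda>h. (flat k (0 + h) - flat k 0) / h) \<longlongrightarrow> 0) (at 0)"
    proof (rule Lim_transform_eventually[OF flat_tendsto_0[of "Suc k"]])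
      show "\<forall>\<^sub>F h in at 0. flat (Suc k) h = (flat k (0 + h) - flat k 0) / h"
        unfolding eventually_at_filter
        by (intro always_eventually) (auto simp: flat_def field_simps)
    qed
    then have "(flat k has_field_derivative 0) (at 0)" unfolding DERIV_def .
    then show ?thesis using 2 by (simp add: flat_def)
  next
    case 3
    have "((\<lambda>x. inverse x ^ k * exp (- inverse x)) has_field_derivative
        (flat (k + 2) x - real k * flat (k + 1) x)) (at x)"
    proof (cases k)
      case 0
      have "((\<lambda>x. exp (- inverse x)) has_field_derivative exp (- inverse x) * (inverse x * inverse x)) (at x)"
        using 3 by (auto intro!: derivative_eq_intros simp: power2_eq_square)
      then show ?thesis using 0 3 by (simp add: flat_def power2_eq_square mult.commute)
    next
      case (Suc m)
      have inv: "((\<lambda>x. inverse x) has_field_derivative - (inverse x * inverse x)) (at x)"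
        using 3 by (auto intro!: derivative_eq_intros simp: power2_eq_square)
      have "((\<lambda>x. exp (- inverse x)) has_field_derivative exp (- inverse x) * (inverse x * inverse x)) (at x)"
        using 3 by (auto intro!: derivative_eq_intros simp: power2_eq_square)
      from DERIV_mult[OF DERIV_power_Suc[OF inv, of m] this]
      show ?thesis using Suc 3 by (simp add: flat_def algebra_simps)
    qed
    then show ?thesis
      by (rule has_field_derivative_transform_within_open[where S = "{0<..}"])
        (use 3 in \<open>auto simp: flat_def\<close>)
  qed
qed

text \<open>
A set of functions that contains what is needed for the cutoff functions and is visibly closed under
differentiation, so that \<open>smooth_coinduct\<close> applies to it. Smooth functions are included as generators in
order to obtain the product rule for them.
\<close>

inductive_set smooth_closure :: "(real \<Rightarrow> real) set" where
  smooth: "smooth f \<Longrightarrow> f \<in> smooth_closure"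
| const: "(\<lambda>x. c) \<in> smooth_closure"
| flat: "(\<lambda>x. flat k (c * x + d)) \<in> smooth_closure"
| add: "f \<in> smooth_closure \<Longrightarrow> g \<in> smooth_closure \<Longrightarrow> (\<lambda>x. f x + g x) \<in> smooth_closure"
| mult: "f \<in> smooth_closure \<Longrightarrow> g \<in> smooth_closure \<Longrightarrow> (\<lambda>x. f x * g x) \<in> smooth_closure"
| inverse: "f \<in> smooth_closure \<Longrightarrow> (\<And>x. f x \<noteq> 0) \<Longrightarrow> (\<lambda>x. inverse (f x)) \<in> smooth_closure"

lemma smooth_closure_DERIV:
  "f \<in> smooth_closure \<Longrightarrow> \<exists>g\<in>smooth_closure. \<forall>x. (f has_field_derivative g x) (at x)"
proof (induction rule: smooth_closure.induct)
  case (smooth f)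
  then show ?case
    using smooth_DERIV smooth_deriv smooth_closure.smooth by blast
next
  case (const c)
  show ?case
    by (rule bexI[of _ "\<lambda>x. 0"]) (auto intro: smooth_closure.const)
next
  case (flat k c d)
  let ?g = "\<lambda>x. c * (flat (k + 2) (c * x + d) + (- real k) * flat (k + 1) (c * x + d))"
  have "?g \<in> smooth_closure"
    by (intro smooth_closure.mult smooth_closure.add smooth_closure.const smooth_closure.flat)
  moreover have "((\<lambda>x. flat k (c * x + d)) has_field_derivative ?g x) (at x)" for x
  proof -
    have "((\<lambda>x. c * x + d) has_field_derivative c) (at x)"
      by (auto intro!: derivative_eq_intros)
    from DERIV_chain2[OF flat_DERIV this] show ?thesis
      by (simp add: algebra_simps)
  qed
  ultimately show ?case by (intro bexI[of _ ?g]) auto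
next
  case (add f g)
  then obtain f' g' where *: "f' \<in> smooth_closure" "g' \<in> smooth_closure"
    "\<And>x. (f has_field_derivative f' x) (at x)" "\<And>x. (g has_field_derivative g' x) (at x)" by blast
  have "((\<lambda>x. f x + g x) has_field_derivative f' x + g' x) (at x)" for x
    by (rule DERIV_add[OF *(3,4)])
  then show ?case
    using smooth_closure.add[OF *(1,2)] by (intro bexI[of _ "\<lambda>x. f' x + g' x"] allI)
next
  case (mult f g)
  then obtain f' g' where *: "f' \<in> smooth_closure" "g' \<in> smooth_closure"
    "\<And>x. (f has_field_derivative f' x) (at x)" "\<And>x. (g has_field_derivative g' x) (at x)" by blast
  have "((\<lambda>x. f x * g x) has_field_derivative f' x * g x + g' x * f x) (at x)" for x
    by (rule DERIV_mult[OF *(3,4)])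
  moreover have "(\<lambda>x. f' x * g x + g' x * f x) \<in> smooth_closure"
    by (intro smooth_closure.add smooth_closure.mult * mult.hyps)
  ultimately show ?case by (intro bexI[of _ "\<lambda>x. f' x * g x + g' x * f x"] allI)
next
  case (inverse f)
  then obtain f' where *: "f' \<in> smooth_closure" "\<And>x. (f has_field_derivative f' x) (at x)" by blast
  let ?g = "\<lambda>x. (-1) * (inverse (f x) * f' x * inverse (f x))"
  have "((\<lambda>x. inverse (f x)) has_field_derivative ?g x) (at x)" for x
    using DERIV_inverse'[OF *(2)[of x] inverse.hyps(2)[of x]] by simp
  moreover have "?g \<in> smooth_closure"
    by (intro smooth_closure.const smooth_closure.mult smooth_closure.inverse * inverse.hyps)
  ultimately show ?case by (intro bexI[of _ ?g] allI)
qed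

lemma smooth_closure_smooth: "f \<in> smooth_closure \<Longrightarrow> smooth f"
  by (rule smooth_coinduct) (auto dest: smooth_closure_DERIV)

lemma smooth_mult: "smooth f \<Longrightarrow> smooth g \<Longrightarrow> smooth (\<lambda>x. f x * g x)"
  by (rule smooth_closure_smooth) (intro smooth_closure.mult smooth_closure.smooth)

lemma smooth_diff: "smooth f \<Longrightarrow> smooth g \<Longrightarrow> smooth (\<lambda>x. f x - g x)"
proof -
  assume "smooth f" "smooth g"
  then have "(\<lambda>x. f x + (-1) * g x) \<in> smooth_closure"
    by (intro smooth_closure.add smooth_closure.mult smooth_closure.const smooth_closure.smooth)
  from smooth_closure_smooth[OF this] show ?thesis by simp
qed

lemma smooth_const: "smooth (\<lambda>x. c)"
  by (rule smooth_closure_smooth) (rule smooth_closure.const)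

lemma smooth_continuous_on: "smooth f \<Longrightarrow> continuous_on S f"
  by (meson DERIV_continuous_on has_field_derivative_at_within smooth_DERIV)

text \<open>
A nondecreasing smooth function that is \<open>0\<close> on \<open>(-\<infinity>, 0]\<close> and \<open>1\<close> on \<open>[1, \<infinity>)\<close>.
\<close>

definition step :: "real \<Rightarrow> real" where
  "step x = flat 0 x * inverse (flat 0 x + flat 0 (1 - x))"

lemma flat_0_nonneg: "flat 0 x \<ge> 0"
  by (simp add: flat_def)

lemma flat_0_sum_pos: "flat 0 x + flat 0 (1 - x) > 0"
  by (auto simp: flat_def intro: add_pos_nonneg)

lemma smooth_step_affine: "smooth (\<lambda>x. step (c * x + d))"
proof -
  have eq: "1 - (c * x + d) = (- c) * x + (1 - d)" for x
    by (simp add: algebra_simps)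
  have "(\<lambda>x. flat 0 (c * x + d) * inverse (flat 0 (c * x + d) + flat 0 ((- c) * x + (1 - d))))
      \<in> smooth_closure"
    using flat_0_sum_pos[of "c * x + d" for x] unfolding eq
    by (intro smooth_closure.mult smooth_closure.inverse smooth_closure.add smooth_closure.flat)
      (metis less_irrefl)
  then show ?thesis
    unfolding step_def eq by (rule smooth_closure_smooth)
qed

lemma step_0: "x \<le> 0 \<Longrightarrow> step x = 0"
  by (simp add: step_def flat_def)

lemma step_1: "x \<ge> 1 \<Longrightarrow> step x = 1"
  by (simp add: step_def flat_def)

lemma step_bounds: "0 \<le> step x" "step x \<le> 1"
  using flat_0_nonneg[of x] flat_0_nonneg[of "1 - x"] flat_0_sum_pos[of x]
  by (auto simp: step_def field_simps)

lemma flat_0_mono: "x \<le> y \<Longrightarrow> flat 0 x \<le> flat 0 y"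
  by (auto simp: flat_def le_imp_inverse_le)

lemma step_mono: "x \<le> y \<Longrightarrow> step x \<le> step y"
proof -
  assume "x \<le> y"
  then have "flat 0 x * flat 0 (1 - y) \<le> flat 0 y * flat 0 (1 - x)"
    by (intro mult_mono flat_0_mono flat_0_nonneg) auto
  then show ?thesis
    using flat_0_sum_pos[of x] flat_0_sum_pos[of y]
    by (simp add: step_def field_simps)
qed

section \<open>Integration by parts for weak derivatives\<close>

text \<open>
The transition from \<open>0\<close> to \<open>1\<close> takes place on \<open>[x, x + 1/c]\<close>. The argument is written as an affine function
of \<open>s\<close> so that the closure rules for smooth functions apply directly.
\<close>

definition cutoff :: "real \<Rightarrow> real \<Rightarrow> real \<Rightarrow> real" where
  "cutoff c x s = step (c * s + - c * x)"

lemma smooth_cutoff: "smooth (cutoff c x)"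
  unfolding cutoff_def[abs_def] by (rule smooth_step_affine)

lemma cutoff_bounds: "0 \<le> cutoff c x s" "cutoff c x s \<le> 1"
  by (auto simp: cutoff_def step_bounds)

lemma cutoff_0: "c > 0 \<Longrightarrow> s \<le> x \<Longrightarrow> cutoff c x s = 0"
  unfolding cutoff_def by (intro step_0) (simp add: field_simps)

lemma cutoff_1: "c > 0 \<Longrightarrow> x + inverse c \<le> s \<Longrightarrow> cutoff c x s = 1"
  unfolding cutoff_def by (intro step_1) (simp add: field_simps)

lemma deriv_cutoff_nonneg:
  assumes "c > 0"
  shows "deriv (cutoff c x) s \<ge> 0"
proof (rule mono_on_imp_deriv_nonneg)
  show "mono_on UNIV (cutoff c x)"
    using assms by (intro mono_onI) (auto simp: cutoff_def intro!: step_mono)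
qed (auto intro: smooth_DERIV smooth_cutoff)

lemma deriv_cutoff_0:
  assumes "c > 0" "s \<notin> {x..x + inverse c}"
  shows "deriv (cutoff c x) s = 0"
proof (cases "s < x")
  case True
  have "(cutoff c x has_field_derivative 0) (at s)"
    by (rule has_field_derivative_transform_within_open[OF DERIV_const, where S = "{..<x}"])
      (use True assms(1) in \<open>auto simp: cutoff_0\<close>)
  then show ?thesis by (rule DERIV_imp_deriv)
next
  case False
  have "(cutoff c x has_field_derivative 0) (at s)"
    by (rule has_field_derivative_transform_within_open[OF DERIV_const, where S = "{x + inverse c<..}"])
      (use False assms in \<open>auto simp: cutoff_1\<close>)
  then show ?thesis by (rule DERIV_imp_deriv)
qed

lemma smooth_has_integral:
  assumes "smooth f" "x \<le> y"
  shows "(deriv f has_integral f y - f x) {x..y}"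
  using assms smooth_DERIV[OF assms(1)]
  by (intro fundamental_theorem_of_calculus)
    (auto simp: has_real_derivative_iff_has_vector_derivative[symmetric]
      intro: has_field_derivative_at_within)

lemma set_integral_superset:
  fixes f :: "'a \<Rightarrow> 'b::{banach, second_countable_topology}"
  assumes "A \<subseteq> B" "\<And>x. x \<in> B - A \<Longrightarrow> f x = 0"
  shows "(LINT x:A|M. f x) = (LINT x:B|M. f x)"
  unfolding set_lebesgue_integral_def
  by (rule Bochner_Integration.integral_cong) (use assms in \<open>auto simp: indicator_def\<close>)

text \<open>
The derivatives of the cutoff functions are nonnegative, have integral \<open>1\<close> and are supported on
\<open>[x, x + 1/c]\<close>. Hence they form an approximate identity at \<open>x\<close>.
\<close>

lemma cutoff_kernel:
  fixes f :: "real \<Rightarrow> 'v::euclidean_space"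
  assumes f: "continuous_on {a..b} f" and x: "a < x" "x < b"
  shows "(\<lambda>n. LINT s:{a<..<b}|lebesgue. deriv (cutoff (real (Suc n)) x) s *\<^sub>R f s) \<longlonglongrightarrow> f x"
proof (rule LIMSEQ_I)
  fix e :: real assume "e > 0"
  have "continuous (at x within {a..b}) f"
    using f x by (auto simp: continuous_on_eq_continuous_within)
  then obtain d where d: "d > 0" "\<And>s. s \<in> {a..b} \<Longrightarrow> dist s x < d \<Longrightarrow> dist (f s) (f x) < e / 2"
    using \<open>e > 0\<close> unfolding continuous_within_eps_delta by (meson half_gt_zero)
  obtain N where N: "inverse (real (Suc N)) < min d (b - x)"
    using reals_Archimedean[of "min d (b - x)"] d x by auto
  show "\<exists>no. \<forall>n\<ge>no. norm ((LINT s:{a<..<b}|lebesgue. deriv (cutoff (real (Suc n)) x) s *\<^sub>R f s) - f x) < e"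
  proof (intro exI[of _ N] allI impI)
    fix n assume "n \<ge> N"
    define c where "c = real (Suc n)"
    define k where "k = deriv (cutoff c x)"
    define I where "I = {x..x + inverse c}"
    have c: "c > 0" by (simp add: c_def)
    have "inverse c \<le> inverse (real (Suc N))"
      using \<open>n \<ge> N\<close> by (auto simp: c_def intro!: le_imp_inverse_le)
    then have small: "inverse c < d" "inverse c < b - x" using N by auto
    have "inverse c > 0" using c by simp
    then have I: "I \<subseteq> {a<..<b}" "I \<subseteq> {a..b}" using x small by (auto simp: I_def)
    have k: "continuous_on I k"
      unfolding k_def by (intro smooth_continuous_on smooth_deriv smooth_cutoff)
    have fI: "continuous_on I f" using f I continuous_on_subset by blast
    have "cutoff c x (x + inverse c) - cutoff c x x = 1" using c by (simp add: cutoff_0 cutoff_1)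
    then have k1: "(k has_integral 1) I"
      unfolding k_def I_def
      using smooth_has_integral[OF smooth_cutoff[of c x], of x "x + inverse c"] c by simp
    have "(LINT s:{a<..<b}|lebesgue. k s *\<^sub>R f s) = (LINT s:I|lebesgue. k s *\<^sub>R f s)"
      by (rule set_integral_superset[symmetric]) (use I c in \<open>auto simp: k_def I_def intro!: deriv_cutoff_0\<close>)
    also have "\<dots> = integral I (\<lambda>s. k s *\<^sub>R f s)"
      using k fI unfolding I_def
      by (intro set_lebesgue_integral_eq_integral absolutely_integrable_continuous_real continuous_intros)
    finally have 1: "(LINT s:{a<..<b}|lebesgue. k s *\<^sub>R f s) = integral I (\<lambda>s. k s *\<^sub>R f s)" .
    have int: "(\<lambda>s. k s *\<^sub>R f s) integrable_on I"
      using k fI unfolding I_def by (intro integrable_continuous_real continuous_intros)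
    have "((\<lambda>s. k s *\<^sub>R f x) has_integral 1 *\<^sub>R f x) I"
      by (rule has_integral_scaleR_left[OF k1])
    from has_integral_diff[OF integrable_integral[OF int] this]
    have 2: "((\<lambda>s. k s *\<^sub>R (f s - f x)) has_integral integral I (\<lambda>s. k s *\<^sub>R f s) - f x) I"
      by (simp add: scaleR_diff_right)
    have 3: "((\<lambda>s. k s * (e / 2)) has_integral 1 * (e / 2)) I"
      by (rule has_integral_mult_left[OF k1])
    have "norm (integral I (\<lambda>s. k s *\<^sub>R (f s - f x))) \<le> integral I (\<lambda>s. k s * (e / 2))"
    proof (rule Henstock_Kurzweil_Integration.integral_norm_bound_integral)
      fix s assume "s \<in> I"
      then have "s \<in> {a..b}" "dist s x < d" using I(2) small by (blast, auto simp: I_def dist_real_def)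
      then have "norm (f s - f x) \<le> e / 2" using d(2)[of s] by (simp add: dist_norm)
      moreover have "k s \<ge> 0" using deriv_cutoff_nonneg[OF c] by (simp add: k_def)
      ultimately show "norm (k s *\<^sub>R (f s - f x)) \<le> k s * (e / 2)"
        using mult_left_mono[of "norm (f s - f x)" "e / 2" "k s"] by simp
    qed (use 2 3 in blast)+
    then have "norm ((LINT s:{a<..<b}|lebesgue. k s *\<^sub>R f s) - f x) \<le> e / 2"
      unfolding 1 integral_unique[OF 2] integral_unique[OF 3] by simp
    then show "norm ((LINT s:{a<..<b}|lebesgue. deriv (cutoff (real (Suc n)) x) s *\<^sub>R f s) - f x) < e"
      using \<open>e > 0\<close> unfolding k_def c_def by linarith
  qed
qed

lemma cutoff_indicator_limit:
  "(\<lambda>n. cutoff (real (Suc n)) x s) \<longlonglongrightarrow> (if s \<le> x then 0 else 1)"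
proof (cases "s \<le> x")
  case True
  then have "(\<lambda>n. cutoff (real (Suc n)) x s) = (\<lambda>n. 0)" by (auto simp: cutoff_0)
  then show ?thesis using True by simp
next
  case False
  then obtain N where N: "inverse (real (Suc N)) < s - x"
    using reals_Archimedean[of "s - x"] by auto
  have "cutoff (real (Suc n)) x s = 1" if "n \<ge> N" for n
  proof (rule cutoff_1)
    have "inverse (real (Suc n)) \<le> inverse (real (Suc N))"
      using that by (intro le_imp_inverse_le) auto
    then show "x + inverse (real (Suc n)) \<le> s" using N by linarith
  qed simp
  then show ?thesis
    using False by (intro tendsto_eventually eventually_sequentiallyI[of N]) auto
qed

lemma cutoff_integral_limit:
  fixes h :: "real \<Rightarrow> 'v::euclidean_space"
  assumes h: "set_integrable lebesgue {a<..<b} h" and xy: "a < x" "x < y" "y < b"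
  shows "(\<lambda>n. LINT s:{a<..<b}|lebesgue. (cutoff (real (Suc n)) x s - cutoff (real (Suc n)) y s) *\<^sub>R h s)
    \<longlonglongrightarrow> (LINT s:{x..y}|lebesgue. h s)"
proof -
  define H where "H = (\<lambda>s. indicat_real {a<..<b} s *\<^sub>R h s)"
  have H: "integrable lebesgue H" using h by (simp add: set_integrable_def H_def)
  then have [measurable]: "H \<in> borel_measurable lebesgue" by simp
  have cutoff[measurable]: "cutoff c z \<in> borel_measurable lebesgue" for c z
    by (intro measurable_completion) (auto intro!: borel_measurable_continuous_onI smooth_continuous_on smooth_cutoff)
  have "(\<lambda>n. LINT s|lebesgue. (cutoff (real (Suc n)) x s - cutoff (real (Suc n)) y s) *\<^sub>R H s)
      \<longlonglongrightarrow> (LINT s|lebesgue. indicator {x<..y} s *\<^sub>R H s)"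
  proof (rule integral_dominated_convergence[where w = "\<lambda>s. norm (H s)"])
    show "AE s in lebesgue. (\<lambda>n. (cutoff (real (Suc n)) x s - cutoff (real (Suc n)) y s) *\<^sub>R H s)
        \<longlonglongrightarrow> indicator {x<..y} s *\<^sub>R H s"
    proof (intro AE_I2 tendsto_scaleR tendsto_const)
      fix s
      have "(\<lambda>n. cutoff (real (Suc n)) x s - cutoff (real (Suc n)) y s) \<longlonglongrightarrow>
          (if s \<le> x then 0 else 1) - (if s \<le> y then 0 else 1)"
        by (intro tendsto_diff cutoff_indicator_limit)
      moreover have "(if s \<le> x then 0 else 1) - (if s \<le> y then 0 else 1) = indicat_real {x<..y} s"
        using xy by (auto simp: indicator_def)
      ultimately show "(\<lambda>n. cutoff (real (Suc n)) x s - cutoff (real (Suc n)) y s) \<longlonglongrightarrow> indicat_real {x<..y} s"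
        by simp
    qed
    show "AE s in lebesgue. norm ((cutoff (real (Suc n)) x s - cutoff (real (Suc n)) y s) *\<^sub>R H s)
        \<le> norm (H s)" for n
    proof (rule AE_I2)
      fix s
      have "\<bar>cutoff (real (Suc n)) x s - cutoff (real (Suc n)) y s\<bar> \<le> 1"
        using cutoff_bounds[of "real (Suc n)" x s] cutoff_bounds[of "real (Suc n)" y s] by linarith
      then show "norm ((cutoff (real (Suc n)) x s - cutoff (real (Suc n)) y s) *\<^sub>R H s) \<le> norm (H s)"
        unfolding norm_scaleR by (intro mult_left_le_one_le) auto
    qed
    show "integrable lebesgue (\<lambda>s. norm (H s))" using H by simp
    have [measurable]: "indicat_real {x<..y} \<in> borel_measurable lebesgue" by (rule borel_measurable_indicator) simp
    show "(\<lambda>s. indicat_real {x<..y} s *\<^sub>R H s) \<in> borel_measurable lebesgue"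
      "\<And>n. (\<lambda>s. (cutoff (real (Suc n)) x s - cutoff (real (Suc n)) y s) *\<^sub>R H s) \<in> borel_measurable lebesgue"
      by measurable
  qed
  moreover have "(LINT s|lebesgue. indicator {x<..y} s *\<^sub>R H s) = (LINT s:{x<..y}|lebesgue. h s)"
    unfolding set_lebesgue_integral_def
    by (rule Bochner_Integration.integral_cong) (use xy in \<open>auto simp: indicator_def H_def\<close>)
  moreover have "(LINT s:{x<..y}|lebesgue. h s) = (LINT s:{x..y}|lebesgue. h s)"
    by (rule set_integral_discrete_difference[where X = "{x}"]) auto
  moreover have "(LINT s|lebesgue. D s *\<^sub>R H s) = (LINT s:{a<..<b}|lebesgue. D s *\<^sub>R h s)" for D
    unfolding set_lebesgue_integral_def H_def by (simp add: mult.commute)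
  ultimately show ?thesis
    by (simp del: of_nat_Suc)
qed

lemma set_integrable_continuous_scaleR:
  fixes h :: "real \<Rightarrow> 'v::euclidean_space"
  assumes h: "set_integrable lebesgue {a<..<b} h" and \<phi>: "continuous_on UNIV \<phi>"
  shows "set_integrable lebesgue {a<..<b} (\<lambda>s. \<phi> s *\<^sub>R h s)"
proof -
  define H where "H = (\<lambda>s. indicat_real {a<..<b} s *\<^sub>R h s)"
  have H: "integrable lebesgue H" using h by (simp add: set_integrable_def H_def)
  have "bounded (\<phi> ` {a..b})"
    by (intro compact_imp_bounded compact_continuous_image continuous_on_subset[OF \<phi>]) auto
  then obtain B where B: "B > 0" "\<And>s. s \<in> {a..b} \<Longrightarrow> norm (\<phi> s) \<le> B"
    unfolding bounded_pos by auto
  have [measurable]: "\<phi> \<in> borel_measurable lebesgue"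
    by (intro measurable_completion) (auto intro!: borel_measurable_continuous_onI \<phi>)
  have "integrable lebesgue (\<lambda>s. \<phi> s *\<^sub>R H s)"
  proof (rule Bochner_Integration.integrable_bound[of _ "\<lambda>s. B *\<^sub>R H s"])
    show "integrable lebesgue (\<lambda>s. B *\<^sub>R H s)" using H by simp
    show "(\<lambda>s. \<phi> s *\<^sub>R H s) \<in> borel_measurable lebesgue" using H by measurable
    show "AE s in lebesgue. norm (\<phi> s *\<^sub>R H s) \<le> norm (B *\<^sub>R H s)"
      using B by (intro AE_I2) (auto simp: indicator_def H_def intro!: mult_right_mono)
  qed
  then show ?thesis unfolding set_integrable_def H_def by (simp add: mult.commute)
qed

text \<open>
Testing the weak derivative with \<open>\<phi>\<close> times a smooth approximation of the indicator of \<open>[x, y]\<close> produces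
the boundary terms in the limit, from the steep parts of the approximation.
The case \<open>\<phi> = 1\<close> is the fundamental theorem of calculus, and general \<open>\<phi>\<close> is what is needed to
identify the weak derivative of a function that is altered on \<open>[x, y]\<close>.
\<close>

lemma weak_derivative_by_parts:
  fixes u g :: "real \<Rightarrow> 'v::euclidean_space"
  assumes g: "has_weak_derivative a b u g" and u: "continuous_on {a..b} u"
    and \<phi>: "smooth \<phi>" and xy: "a < x" "x < y" "y < b"
  shows "(LINT s:{x..y}|lebesgue. deriv \<phi> s *\<^sub>R u s)
    = \<phi> y *\<^sub>R u y - \<phi> x *\<^sub>R u x - (LINT s:{x..y}|lebesgue. \<phi> s *\<^sub>R g s)"
proof -
  define K where "K n z = (LINT s:{a<..<b}|lebesgue. deriv (cutoff (real (Suc n)) z) s *\<^sub>R (\<phi> s *\<^sub>R u s))" for n z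
  define D where "D n s = cutoff (real (Suc n)) x s - cutoff (real (Suc n)) y s" for n s
  have \<phi>c: "continuous_on S \<phi>" "continuous_on S (deriv \<phi>)" for S
    by (auto intro!: smooth_continuous_on \<phi> smooth_deriv)
  have ui: "set_integrable lebesgue {a<..<b} u"
    by (rule set_integrable_subset[OF absolutely_integrable_continuous_real[OF u]]) auto
  have gi: "set_integrable lebesgue {a<..<b} g"
    using g by (simp add: has_weak_derivative_def)
  have i1: "set_integrable lebesgue {a<..<b} (\<lambda>s. deriv \<phi> s *\<^sub>R u s)"
    by (intro set_integrable_continuous_scaleR ui \<phi>c)
  have i2: "set_integrable lebesgue {a<..<b} (\<lambda>s. \<phi> s *\<^sub>R g s)"
    by (intro set_integrable_continuous_scaleR gi \<phi>c)
  have sD: "smooth (D n)" for n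
    unfolding D_def[abs_def] by (intro smooth_diff smooth_cutoff)
  have dD: "deriv (D n) s = deriv (cutoff (real (Suc n)) x) s - deriv (cutoff (real (Suc n)) y) s" for n s
    unfolding D_def[abs_def] by (intro DERIV_imp_deriv DERIV_diff smooth_DERIV smooth_cutoff)
  have dprod: "deriv (\<lambda>s. \<phi> s * D n s) s = deriv \<phi> s * D n s + deriv (D n) s * \<phi> s" for n s
    by (intro DERIV_imp_deriv DERIV_mult smooth_DERIV \<phi> sD)
  obtain N where N: "inverse (real (Suc N)) < b - y"
    using reals_Archimedean[of "b - y"] xy by auto
  have eq: "(LINT s:{a<..<b}|lebesgue. D n s *\<^sub>R (deriv \<phi> s *\<^sub>R u s)) + (K n x - K n y)
      = - (LINT s:{a<..<b}|lebesgue. D n s *\<^sub>R (\<phi> s *\<^sub>R g s))" if "n \<ge> N" for n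
  proof -
    have "inverse (real (Suc n)) \<le> inverse (real (Suc N))"
      using that by (intro le_imp_inverse_le) auto
    then have n: "y + inverse (real (Suc n)) < b" using N by linarith
    have pos: "inverse (real (Suc n)) > 0" by simp
    have "test_function a b (\<lambda>s. \<phi> s * D n s)"
    proof -
      have "\<forall>s. s \<notin> {x..y + inverse (real (Suc n))} \<longrightarrow> \<phi> s * D n s = 0"
      proof (intro allI impI)
        fix s assume s: "s \<notin> {x..y + inverse (real (Suc n))}"
        show "\<phi> s * D n s = 0"
        proof (cases "s < x")
          case True
          then show ?thesis using xy by (simp add: D_def cutoff_0)
        next
          case False
          then have "y + inverse (real (Suc n)) \<le> s" "x + inverse (real (Suc n)) \<le> s" using s xy by auto
          then show ?thesis by (simp add: D_def cutoff_1 del: of_nat_Suc)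
        qed
      qed
      moreover have "\<forall>k s. (deriv ^^ k) (\<lambda>s. \<phi> s * D n s) field_differentiable at s"
        using smooth_mult[OF \<phi> sD[of n]] by (simp add: smooth_def)
      ultimately show ?thesis
        unfolding test_function_def using xy(1) n by blast
    qed
    then have "(LINT s:{a<..<b}|lebesgue. deriv (\<lambda>s. \<phi> s * D n s) s *\<^sub>R u s)
        = - (LINT s:{a<..<b}|lebesgue. (\<phi> s * D n s) *\<^sub>R g s)"
      using g by (simp add: has_weak_derivative_def)
    moreover have "(LINT s:{a<..<b}|lebesgue. deriv (\<lambda>s. \<phi> s * D n s) s *\<^sub>R u s)
      = (LINT s:{a<..<b}|lebesgue. D n s *\<^sub>R (deriv \<phi> s *\<^sub>R u s)
          + (deriv (cutoff (real (Suc n)) x) s *\<^sub>R (\<phi> s *\<^sub>R u s)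
             - deriv (cutoff (real (Suc n)) y) s *\<^sub>R (\<phi> s *\<^sub>R u s)))"
      unfolding dprod dD
      by (rule arg_cong[where f = "set_lebesgue_integral lebesgue {a<..<b}"])
        (auto simp: algebra_simps)
    moreover have "\<dots> = (LINT s:{a<..<b}|lebesgue. D n s *\<^sub>R (deriv \<phi> s *\<^sub>R u s)) + (K n x - K n y)"
    proof -
      have k: "set_integrable lebesgue {a<..<b} (\<lambda>s. deriv (cutoff (real (Suc n)) z) s *\<^sub>R (\<phi> s *\<^sub>R u s))" for z
        by (intro set_integrable_continuous_scaleR ui \<phi>c smooth_continuous_on smooth_deriv smooth_cutoff)
      have d: "set_integrable lebesgue {a<..<b} (\<lambda>s. D n s *\<^sub>R (deriv \<phi> s *\<^sub>R u s))"
        by (intro set_integrable_continuous_scaleR i1 smooth_continuous_on sD)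
      show ?thesis
        unfolding K_def by (simp only: set_integral_add(2)[OF d set_integral_diff(1)[OF k k]] set_integral_diff(2)[OF k k])
    qed
    moreover have "(LINT s:{a<..<b}|lebesgue. (\<phi> s * D n s) *\<^sub>R g s)
        = (LINT s:{a<..<b}|lebesgue. D n s *\<^sub>R (\<phi> s *\<^sub>R g s))"
      by (simp add: mult.commute)
    ultimately show ?thesis by simp
  qed
  have K: "(\<lambda>n. K n z) \<longlonglongrightarrow> \<phi> z *\<^sub>R u z" if "a < z" "z < b" for z
    unfolding K_def using cutoff_kernel[OF continuous_on_scaleR[OF \<phi>c(1) u] that] .
  have "(\<lambda>n. (LINT s:{a<..<b}|lebesgue. D n s *\<^sub>R (deriv \<phi> s *\<^sub>R u s)) + (K n x - K n y))
      \<longlonglongrightarrow> (LINT s:{x..y}|lebesgue. deriv \<phi> s *\<^sub>R u s) + (\<phi> x *\<^sub>R u x - \<phi> y *\<^sub>R u y)"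
    unfolding D_def
    by (intro tendsto_add tendsto_diff K cutoff_integral_limit i1) (use xy in auto)
  moreover have "(\<lambda>n. - (LINT s:{a<..<b}|lebesgue. D n s *\<^sub>R (\<phi> s *\<^sub>R g s)))
      \<longlonglongrightarrow> - (LINT s:{x..y}|lebesgue. \<phi> s *\<^sub>R g s)"
    unfolding D_def
    by (intro tendsto_minus cutoff_integral_limit i2 xy)
  then have "(\<lambda>n. (LINT s:{a<..<b}|lebesgue. D n s *\<^sub>R (deriv \<phi> s *\<^sub>R u s)) + (K n x - K n y))
      \<longlonglongrightarrow> - (LINT s:{x..y}|lebesgue. \<phi> s *\<^sub>R g s)"
    by (rule Lim_transform_eventually) (use eq in \<open>auto intro!: eventually_sequentiallyI[of N]\<close>)
  ultimately have "(LINT s:{x..y}|lebesgue. deriv \<phi> s *\<^sub>R u s) + (\<phi> x *\<^sub>R u x - \<phi> y *\<^sub>R u y)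
      = - (LINT s:{x..y}|lebesgue. \<phi> s *\<^sub>R g s)"
    by (rule LIMSEQ_unique)
  then show ?thesis by (simp add: algebra_simps)
qed

lemma weak_derivative_integral:
  fixes u g :: "real \<Rightarrow> 'v::euclidean_space"
  assumes "has_weak_derivative a b u g" "continuous_on {a..b} u" "a < x" "x < y" "y < b"
  shows "(LINT s:{x..y}|lebesgue. g s) = u y - u x"
  using weak_derivative_by_parts[OF assms(1,2) smooth_const[of 1] assms(3-5)] by simp

text \<open>
Intervals form an intersection-stable generator of the Borel sets, so the integral vanishes over all
Borel sets, and then over all Lebesgue sets because these differ from Borel sets by null sets.
\<close>

lemma AE_zero_if_interval_integrals_zero:
  fixes h :: "real \<Rightarrow> 'v::euclidean_space"
  assumes h: "integrable lebesgue h" and zero: "\<And>x y. x < y \<Longrightarrow> (LINT s:{x..y}|lebesgue. h s) = 0"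
  shows "AE s in lebesgue. h s = 0"
proof (rule sigma_finite_measure.density_zero[OF _ h])
  show "sigma_finite_measure (lebesgue :: real measure)"
  proof
    have "(\<Union>n. {- real n..real n}) = UNIV"
      by (auto simp: abs_le_iff[symmetric] minus_le_iff) (meson abs_le_iff minus_le_iff real_arch_simple)
    then show "\<exists>A. countable A \<and> A \<subseteq> sets (lebesgue :: real measure) \<and> \<Union> A = space (lebesgue :: real measure) \<and> (\<forall>a\<in>A. emeasure lebesgue a \<noteq> \<infinity>)"
      by (intro exI[of _ "range (\<lambda>n::nat. {- real n..real n})"]) auto
  qed
  have hi: "set_integrable lebesgue A h" if "A \<in> sets lebesgue" for A
    unfolding set_integrable_def using integrable_mult_indicator[OF that h] .
  have "(LINT s:UNIV|lebesgue. h s) = 0"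
  proof -
    have "(\<lambda>n. LINT s:{-real n..real n}|lebesgue. h s) \<longlonglongrightarrow> (LINT s:(\<Union>n. {-real n..real n})|lebesgue. h s)"
      by (intro set_integral_cont_up hi) (auto simp: incseq_def)
    moreover have "(\<Union>n. {-real n..real n}) = UNIV"
    proof -
      have "s \<in> (\<Union>n. {-real n..real n})" for s
      proof -
        obtain n where "\<bar>s\<bar> \<le> real n" using real_arch_simple by blast
        then show ?thesis by (intro UN_I[of n]) auto
      qed
      then show ?thesis by blast
    qed
    moreover have "(LINT s:{-real n..real n}|lebesgue. h s) = 0" for n
    proof (cases n)
      case 0
      then show ?thesis
        using set_integral_discrete_difference[of "{0}" "{-real n..real n}" "{}" lebesgue h]
        by (auto simp: set_lebesgue_integral_def)
    qed (auto intro: zero)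
    ultimately show ?thesis by (simp add: LIMSEQ_const_iff)
  qed
  note univ = this
  have borel: "(LINT s:A|lebesgue. h s) = 0" if "A \<in> sigma_sets UNIV (range (\<lambda>(x, y). box x y :: real set))" for A
  proof -
    have stable: "Int_stable (range (\<lambda>(x, y). box x y :: real set))"
      unfolding Int_stable_def
    proof (intro ballI)
      fix A B assume "A \<in> range (\<lambda>(x, y). box x y :: real set)" "B \<in> range (\<lambda>(x, y). box x y :: real set)"
      then obtain x y x' y' where "A = {x<..<y}" "B = {x'<..<y'}" by auto
      then have "A \<inter> B = box (max x x') (min y y')" by auto
      then show "A \<inter> B \<in> range (\<lambda>(x, y). box x y :: real set)" by auto
    qed
    have closed: "range (\<lambda>(x, y). box x y :: real set) \<subseteq> Pow UNIV" by simp
    from stable closed that show ?thesis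
  proof (induction rule: sigma_sets_induct_disjoint)
    case (basic A)
    then obtain x y where A: "A = {x<..<y}" by auto
    show ?case
    proof (cases "x < y")
      case True
      have "(LINT s:A|lebesgue. h s) = (LINT s:{x..y}|lebesgue. h s)"
        unfolding A by (rule set_integral_discrete_difference[where X = "{x, y}"]) auto
      then show ?thesis using zero[OF True] by simp
    qed (simp add: A set_lebesgue_integral_def)
  next
    case (compl A)
    note A = compl(1) and 0 = compl(2)
    have "A \<in> sets borel" using A by (simp add: borel_eq_box)
    then have A': "A \<in> sets lebesgue" by simp
    have "(LINT s:(UNIV - A) \<union> A|lebesgue. h s) = (LINT s:UNIV - A|lebesgue. h s) + (LINT s:A|lebesgue. h s)"
      using A' by (intro set_integral_Un hi) auto
    then show ?case using 0 univ by simp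
  next
    case (union A)
    note d = union(1) and A = union(2) and 0 = union(3)
    have "A i \<in> sets borel" for i using A by (simp add: borel_eq_box subset_eq)
    then have A': "A i \<in> sets lebesgue" for i by simp
    have "(LINT s:(\<Union>i. A i)|lebesgue. h s) = (\<Sum>i. (LINT s:A i|lebesgue. h s))"
      by (rule lebesgue_integral_countable_add) (use d A' in \<open>auto intro!: hi simp: disjoint_family_on_def\<close>)
    then show ?case using 0 by simp
  qed (auto simp: set_lebesgue_integral_def)
  qed
  fix A :: "real set" assume A: "A \<in> sets lebesgue"
  have "main_part lborel A \<in> sets borel"
    using main_part_sets[OF A] by simp
  then have M: "main_part lborel A \<in> sigma_sets UNIV (range (\<lambda>(x, y). box x y))"
    and M': "main_part lborel A \<in> sets lebesgue" by (auto simp: borel_eq_box)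
  have "(LINT s:A|lebesgue. h s) = (LINT s:main_part lborel A|lebesgue. h s)"
  proof (rule set_integral_cong_set)
    show "AE s in lebesgue. (s \<in> main_part lborel A) = (s \<in> A)"
    proof -
      obtain N where N: "N \<in> null_sets lborel" "null_part lborel A \<subseteq> N"
        using null_part[OF A] by auto
      have "AE s in lebesgue. s \<notin> N"
        using N(1) by (intro AE_not_in) (auto simp: null_sets_completionI)
      then show ?thesis
        by eventually_elim (use main_part_null_part_Un[OF A] N(2) in blast)
    qed
  qed (use hi[OF A] hi[OF M'] in \<open>auto simp: set_borel_measurable_def set_integrable_def\<close>)
  then show "(LINT s:A|lebesgue. h s) = 0" using borel[OF M] by simp
qed

section \<open>Cutting a corner\<close>

text \<open>
A single interval is already a division.
\<close>

lemma ac_continuous_on: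
  assumes "ac_on_interval a b u"
  shows "continuous_on {a..b} u"
  unfolding continuous_on_iff
proof (intro ballI allI impI)
  fix x e :: real assume x: "x \<in> {a..b}" and "e > 0"
  then obtain d where d: "d > 0" "\<And>D S. D division_of S \<Longrightarrow> S \<subseteq> {a..b} \<Longrightarrow> (\<Sum>K\<in>D. Sup K - Inf K) < d \<Longrightarrow>
        (\<Sum>K\<in>D. norm (u (Sup K) - u (Inf K))) < e"
    using assms unfolding ac_on_interval_def by meson
  show "\<exists>d>0. \<forall>x'\<in>{a..b}. dist x' x < d \<longrightarrow> dist (u x') (u x) < e"
  proof (intro exI[of _ d] conjI ballI impI)
    fix z assume z: "z \<in> {a..b}" "dist z x < d"
    let ?K = "{min x z..max x z}"
    have "{?K} division_of ?K"
      using division_of_self[of "min x z" "max x z"] by simp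
    moreover have "?K \<subseteq> {a..b}" using x z by auto
    ultimately have "norm (u (max x z) - u (min x z)) < e"
      using d(2)[of "{?K}" ?K] z(2) by (auto simp: dist_real_def)
    then show "dist (u z) (u x) < e"
      by (cases "x \<le> z") (auto simp: dist_norm norm_minus_commute max_def min_def)
  qed (fact d(1))
qed

lemma ac_cong:
  assumes "ac_on_interval a b u" "\<And>s. s \<in> {a..b} \<Longrightarrow> u s = w s"
  shows "ac_on_interval a b w"
  unfolding ac_on_interval_def
proof (intro allI impI)
  fix e :: real assume "e > 0"
  then obtain d where d: "d > 0" "\<And>D S. D division_of S \<Longrightarrow> S \<subseteq> {a..b} \<Longrightarrow> (\<Sum>K\<in>D. Sup K - Inf K) < d \<Longrightarrow>
        (\<Sum>K\<in>D. norm (u (Sup K) - u (Inf K))) < e"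
    using assms(1) unfolding ac_on_interval_def by meson
  have "(\<Sum>K\<in>D. norm (w (Sup K) - w (Inf K))) = (\<Sum>K\<in>D. norm (u (Sup K) - u (Inf K)))"
    if D: "D division_of S" "S \<subseteq> {a..b}" for D S
  proof (rule sum.cong)
    fix K assume K: "K \<in> D"
    then obtain c d where K': "K = {c..d}" "c \<le> d"
      using division_ofD(3,4)[OF D(1) K] by fastforce
    moreover from this have "c \<in> S" "d \<in> S" using division_ofD(2)[OF D(1) K] by auto
    then have "c \<in> {a..b}" "d \<in> {a..b}" using D(2) by blast+
    ultimately show "norm (w (Sup K) - w (Inf K)) = norm (u (Sup K) - u (Inf K))"
      using assms(2) by simp
  qed simp
  then show "\<exists>d>0. \<forall>D S. D division_of S \<longrightarrow> S \<subseteq> {a..b} \<longrightarrow> (\<Sum>K\<in>D. Sup K - Inf K) < d \<longrightarrow>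
        (\<Sum>K\<in>D. norm (w (Sup K) - w (Inf K))) < e"
    using d by auto
qed

lemma ac_add:
  assumes "ac_on_interval a b u" "ac_on_interval a b w"
  shows "ac_on_interval a b (\<lambda>s. u s + w s)"
  unfolding ac_on_interval_def
proof (intro allI impI)
  fix e :: real assume "e > 0"
  then have e: "e / 2 > 0" by simp
  obtain d where d: "d > 0" "\<And>D S. D division_of S \<Longrightarrow> S \<subseteq> {a..b} \<Longrightarrow> (\<Sum>K\<in>D. Sup K - Inf K) < d \<Longrightarrow>
        (\<Sum>K\<in>D. norm (u (Sup K) - u (Inf K))) < e / 2"
    using assms(1) e unfolding ac_on_interval_def by meson
  obtain d' where d': "d' > 0" "\<And>D S. D division_of S \<Longrightarrow> S \<subseteq> {a..b} \<Longrightarrow> (\<Sum>K\<in>D. Sup K - Inf K) < d' \<Longrightarrow>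
        (\<Sum>K\<in>D. norm (w (Sup K) - w (Inf K))) < e / 2"
    using assms(2) e unfolding ac_on_interval_def by meson
  show "\<exists>d>0. \<forall>D S. D division_of S \<longrightarrow> S \<subseteq> {a..b} \<longrightarrow> (\<Sum>K\<in>D. Sup K - Inf K) < d \<longrightarrow>
        (\<Sum>K\<in>D. norm (u (Sup K) + w (Sup K) - (u (Inf K) + w (Inf K)))) < e"
  proof (intro exI[of _ "min d d'"] conjI allI impI)
    fix D S assume D: "D division_of S" "S \<subseteq> {a..b}" "(\<Sum>K\<in>D. Sup K - Inf K) < min d d'"
    have "(\<Sum>K\<in>D. norm (u (Sup K) + w (Sup K) - (u (Inf K) + w (Inf K))))
        \<le> (\<Sum>K\<in>D. norm (u (Sup K) - u (Inf K)) + norm (w (Sup K) - w (Inf K)))"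
      by (intro sum_mono) (metis add_diff_add norm_triangle_ineq)
    also have "\<dots> < e"
      using d(2)[of D S] d'(2)[of D S] D by (simp add: sum.distrib)
    finally show "(\<Sum>K\<in>D. norm (u (Sup K) + w (Sup K) - (u (Inf K) + w (Inf K)))) < e" .
  qed (use d d' in auto)
qed

lemma ac_affine: "ac_on_interval a b (\<lambda>s. A + s *\<^sub>R q)"
  unfolding ac_on_interval_def
proof (intro allI impI)
  fix e :: real assume "e > 0"
  show "\<exists>d>0. \<forall>D S. D division_of S \<longrightarrow> S \<subseteq> {a..b} \<longrightarrow> (\<Sum>K\<in>D. Sup K - Inf K) < d \<longrightarrow>
        (\<Sum>K\<in>D. norm (A + Sup K *\<^sub>R q - (A + Inf K *\<^sub>R q))) < e"
  proof (intro exI[of _ "e / (norm q + 1)"] conjI allI impI)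
    fix D S assume D: "D division_of S" "S \<subseteq> {a..b}" "(\<Sum>K\<in>D. Sup K - Inf K) < e / (norm q + 1)"
    have le: "Inf K \<le> Sup K" if "K \<in> D" for K
      using division_ofD(3,4)[OF D(1) that] by fastforce
    have "(\<Sum>K\<in>D. norm (A + Sup K *\<^sub>R q - (A + Inf K *\<^sub>R q))) = (\<Sum>K\<in>D. (Sup K - Inf K) * norm q)"
      using le by (intro sum.cong) (auto simp: scaleR_diff_left[symmetric])
    also have "\<dots> = (\<Sum>K\<in>D. Sup K - Inf K) * norm q" by (simp add: sum_distrib_right)
    also have "\<dots> \<le> (\<Sum>K\<in>D. Sup K - Inf K) * (norm q + 1)"
      using le by (intro mult_left_mono sum_nonneg) auto
    also have "\<dots> < e" using D(3) by (simp add: pos_less_divide_eq add_nonneg_pos)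
    finally show "(\<Sum>K\<in>D. norm (A + Sup K *\<^sub>R q - (A + Inf K *\<^sub>R q))) < e" .
  qed (use \<open>e > 0\<close> in \<open>simp add: add_nonneg_pos\<close>)
qed

text \<open>
The clamp onto \<open>[p, q]\<close> is monotone and maps each interval of a division into itself or to a point, so it maps a
division to a division of no larger total length, once the intervals that collapse are discarded.
\<close>

lemma ac_clamp:
  assumes u: "ac_on_interval a b u" and pq: "a \<le> p" "p \<le> q" "q \<le> b"
  shows "ac_on_interval a b (\<lambda>s. u (max p (min q s)))"
  unfolding ac_on_interval_def
proof (intro allI impI)
  define \<kappa> where "\<kappa> s = max p (min q s)" for s
  fix e :: real assume "e > 0"
  then obtain d where d: "d > 0" "\<And>D S. D division_of S \<Longrightarrow> S \<subseteq> {a..b} \<Longrightarrow> (\<Sum>K\<in>D. Sup K - Inf K) < d \<Longrightarrow>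
        (\<Sum>K\<in>D. norm (u (Sup K) - u (Inf K))) < e"
    using u unfolding ac_on_interval_def by meson
  show "\<exists>d>0. \<forall>D S. D division_of S \<longrightarrow> S \<subseteq> {a..b} \<longrightarrow> (\<Sum>K\<in>D. Sup K - Inf K) < d \<longrightarrow>
        (\<Sum>K\<in>D. norm (u (max p (min q (Sup K))) - u (max p (min q (Inf K))))) < e"
  proof (intro exI[of _ d] conjI allI impI)
    fix D S assume D: "D division_of S" "S \<subseteq> {a..b}" "(\<Sum>K\<in>D. Sup K - Inf K) < d"
    \<comment> \<open>Intervals outside \<open>P\<close> collapse to points: they contribute nothing, and their images could coincide.\<close>
    define P where "P = {K \<in> D. \<kappa> (Inf K) < \<kappa> (Sup K)}"
    define J where "J K = {\<kappa> (Inf K)..\<kappa> (Sup K)}" for K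
    have fin: "finite D" "finite P" using division_ofD(1)[OF D(1)] by (auto simp: P_def)
    have box: "\<exists>c d. K = {c..d} \<and> c \<le> d" if "K \<in> D" for K
      using division_ofD(3,4)[OF D(1) that] by fastforce
    have le: "Inf K \<le> Sup K" if "K \<in> D" for K using box[OF that] by auto
    have \<kappa>mono: "\<kappa> (Inf K) \<le> \<kappa> (Sup K)" if "K \<in> D" for K
      using le[OF that] by (auto simp: \<kappa>_def)
    have JK: "J K \<subseteq> K" "interior (J K) \<noteq> {}" "J K \<noteq> {}" if "K \<in> P" for K
    proof -
      have "K \<in> D" using that by (simp add: P_def)
      then obtain c d where K: "K = {c..d}" "c \<le> d" using box by blast
      moreover have "\<kappa> c < \<kappa> d" using that K by (auto simp: P_def)
      ultimately show "J K \<subseteq> K" "interior (J K) \<noteq> {}" "J K \<noteq> {}"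
        by (auto simp: J_def \<kappa>_def max_def min_def split: if_splits)
    qed
    have disj: "interior (J K1) \<inter> interior (J K2) = {}" if "K1 \<in> P" "K2 \<in> P" "K1 \<noteq> K2" for K1 K2
    proof -
      have "interior K1 \<inter> interior K2 = {}"
        using division_ofD(5)[OF D(1)] that by (auto simp: P_def)
      then show ?thesis using interior_mono[OF JK(1)] that by blast
    qed
    have inj: "inj_on J P"
      using disj JK(2) by (intro inj_onI) (metis inf.idem)
    have div: "J ` P division_of \<Union>(J ` P)"
    proof (rule division_ofI)
      show "finite (J ` P)" using fin by simp
      show "K \<noteq> {}" if "K \<in> J ` P" for K using that JK by auto
      show "\<exists>a b. K = cbox a b" if "K \<in> J ` P" for K using that by (auto simp: J_def)
      show "interior K1 \<inter> interior K2 = {}" if "K1 \<in> J ` P" "K2 \<in> J ` P" "K1 \<noteq> K2" for K1 K2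
        using that disj by auto
    qed auto
    have ab: "\<Union>(J ` P) \<subseteq> {a..b}"
      using pq by (auto simp: J_def \<kappa>_def)
    have SI: "Sup (J K) = \<kappa> (Sup K)" "Inf (J K) = \<kappa> (Inf K)" if "K \<in> P" for K
      using that by (auto simp: J_def P_def)
    have "(\<Sum>K\<in>J ` P. Sup K - Inf K) = (\<Sum>K\<in>P. \<kappa> (Sup K) - \<kappa> (Inf K))"
      by (subst sum.reindex[OF inj]) (auto simp: SI)
    also have "\<dots> \<le> (\<Sum>K\<in>P. Sup K - Inf K)"
      using le by (intro sum_mono) (auto simp: \<kappa>_def P_def)
    also have "\<dots> \<le> (\<Sum>K\<in>D. Sup K - Inf K)"
      using le fin by (intro sum_mono2) (auto simp: P_def)
    finally have "(\<Sum>K\<in>J ` P. norm (u (Sup K) - u (Inf K))) < e"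
      using d(2)[OF div ab] D(3) by linarith
    also have "(\<Sum>K\<in>J ` P. norm (u (Sup K) - u (Inf K))) = (\<Sum>K\<in>P. norm (u (\<kappa> (Sup K)) - u (\<kappa> (Inf K))))"
      by (subst sum.reindex[OF inj]) (auto simp: SI)
    also have "\<dots> = (\<Sum>K\<in>D. norm (u (\<kappa> (Sup K)) - u (\<kappa> (Inf K))))"
    proof (rule sum.mono_neutral_left)
      show "\<forall>K\<in>D - P. norm (u (\<kappa> (Sup K)) - u (\<kappa> (Inf K))) = 0"
      proof
        fix K assume "K \<in> D - P"
        then have "\<kappa> (Sup K) = \<kappa> (Inf K)" using \<kappa>mono[of K] by (auto simp: P_def)
        then show "norm (u (\<kappa> (Sup K)) - u (\<kappa> (Inf K))) = 0" by simp
      qed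
    qed (use fin in \<open>auto simp: P_def\<close>)
    finally show "(\<Sum>K\<in>D. norm (u (max p (min q (Sup K))) - u (max p (min q (Inf K))))) < e"
      unfolding \<kappa>_def .
  qed (fact d(1))
qed

definition slope :: "real \<Rightarrow> real \<Rightarrow> (real \<Rightarrow> 'v::real_vector) \<Rightarrow> 'v" where
  "slope x y v = (v y - v x) /\<^sub>R (y - x)"

definition chord :: "real \<Rightarrow> real \<Rightarrow> (real \<Rightarrow> 'v::real_vector) \<Rightarrow> real \<Rightarrow> 'v" where
  "chord x y v s = v x + (s - x) *\<^sub>R slope x y v"

definition cut_corner :: "real \<Rightarrow> real \<Rightarrow> (real \<Rightarrow> 'v::real_vector) \<Rightarrow> real \<Rightarrow> 'v" where
  "cut_corner x y v s = (if s \<in> {x..y} then chord x y v s else v s)"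

lemma slope_scaleR: "x < y \<Longrightarrow> (y - x) *\<^sub>R slope x y v = v y - v x"
  by (simp add: slope_def)

lemma chord_ends: "chord x y v x = v x" "x < y \<Longrightarrow> chord x y v y = v y"
  by (auto simp: chord_def slope_scaleR)

lemma continuous_on_chord:
  fixes v :: "real \<Rightarrow> 'v::real_normed_vector"
  shows "continuous_on S (chord x y v)"
  unfolding chord_def[abs_def] by (intro continuous_intros)

lemma ac_chord: "ac_on_interval a b (chord x y v)"
proof (rule ac_cong[OF ac_affine])
  fix s
  show "(v x - x *\<^sub>R slope x y v) + s *\<^sub>R slope x y v = chord x y v s"
    by (simp add: chord_def algebra_simps)
qed

text \<open>
The function is a sum of three pieces, each composed with the clamp onto its own interval, up to
a constant.
\<close>

lemma ac_cut_corner: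
  assumes v: "ac_on_interval a b v" and xy: "a \<le> x" "x < y" "y \<le> b"
  shows "ac_on_interval a b (cut_corner x y v)"
proof -
  have c: "ac_on_interval a b (\<lambda>s. v (max a (min x s)))" "ac_on_interval a b (\<lambda>s. v (max y (min b s)))"
    "ac_on_interval a b (\<lambda>s. chord x y v (max x (min y s)))"
    using xy by (simp_all add: ac_clamp[OF v] ac_clamp[OF ac_chord])
  have "ac_on_interval a b (\<lambda>s. - v x - v y + s *\<^sub>R 0)" by (rule ac_affine)
  from ac_add[OF ac_add[OF ac_add[OF c(1) c(3)] c(2)] this]
  show ?thesis
  proof (rule ac_cong)
    fix s assume "s \<in> {a..b}"
    then show "v (max a (min x s)) + chord x y v (max x (min y s)) + v (max y (min b s)) + (- v x - v y + s *\<^sub>R 0)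
      = cut_corner x y v s"
      using xy by (cases "s = y") (auto simp: cut_corner_def chord_ends max_def min_def)
  qed
qed

lemma chord_by_parts:
  fixes v :: "real \<Rightarrow> 'v::euclidean_space"
  assumes \<phi>: "smooth \<phi>" and xy: "x < y"
  shows "(LINT s:{x..y}|lebesgue. deriv \<phi> s *\<^sub>R chord x y v s)
    = \<phi> y *\<^sub>R v y - \<phi> x *\<^sub>R v x - (LINT s:{x..y}|lebesgue. \<phi> s *\<^sub>R slope x y v)"
proof -
  let ?q = "slope x y v"
  have c: "continuous_on {x..y} (\<lambda>s. deriv \<phi> s *\<^sub>R chord x y v s)" "continuous_on {x..y} (\<lambda>s. \<phi> s *\<^sub>R ?q)"
    by (intro continuous_on_scaleR continuous_on_const continuous_on_chord
        smooth_continuous_on[OF \<phi>] smooth_continuous_on[OF smooth_deriv[OF \<phi>]])+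
  have eq: "(LINT s:{x..y}|lebesgue. f s) = integral {x..y} f" if "continuous_on {x..y} f" for f :: "real \<Rightarrow> 'v"
    by (intro set_lebesgue_integral_eq_integral absolutely_integrable_continuous_real that)
  have chord_deriv: "(chord x y v has_vector_derivative ?q) (at s within {x..y})" for s
  proof -
    have "((\<lambda>s. s - x) has_field_derivative 1) (at s within {x..y})"
      by (auto intro!: derivative_eq_intros)
    from has_vector_derivative_add[OF has_vector_derivative_const[of "v x"] has_vector_derivative_scaleR[OF this has_vector_derivative_const[of ?q]]]
    show ?thesis unfolding chord_def[abs_def] by simp
  qed
  have \<phi>_deriv: "(\<phi> has_field_derivative deriv \<phi> s) (at s within {x..y})" for s
    by (rule has_field_derivative_at_within[OF smooth_DERIV[OF \<phi>]])
  have 1: "((\<lambda>s. \<phi> s *\<^sub>R ?q + deriv \<phi> s *\<^sub>R chord x y v s) has_integral \<phi> y *\<^sub>R chord x y v y - \<phi> x *\<^sub>R chord x y v x) {x..y}"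
  proof (rule fundamental_theorem_of_calculus)
    show "((\<lambda>s. \<phi> s *\<^sub>R chord x y v s) has_vector_derivative \<phi> s *\<^sub>R ?q + deriv \<phi> s *\<^sub>R chord x y v s)
        (at s within {x..y})" for s
      by (rule has_vector_derivative_scaleR[OF \<phi>_deriv chord_deriv])
  qed (use xy in simp)
  have 2: "((\<lambda>s. \<phi> s *\<^sub>R ?q + deriv \<phi> s *\<^sub>R chord x y v s) has_integral
      integral {x..y} (\<lambda>s. \<phi> s *\<^sub>R ?q) + integral {x..y} (\<lambda>s. deriv \<phi> s *\<^sub>R chord x y v s)) {x..y}"
    by (intro has_integral_add integrable_integral integrable_continuous_real c)
  have "\<phi> y *\<^sub>R v y - \<phi> x *\<^sub>R v x
      = integral {x..y} (\<lambda>s. \<phi> s *\<^sub>R ?q) + integral {x..y} (\<lambda>s. deriv \<phi> s *\<^sub>R chord x y v s)"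
    using has_integral_unique[OF 1 2] by (simp only: chord_ends(1) chord_ends(2)[OF xy])
  then show ?thesis by (simp add: eq[OF c(1)] eq[OF c(2)])
qed

lemma set_integral_open_closed:
  fixes f :: "real \<Rightarrow> 'v::euclidean_space"
  shows "(LINT s:{a<..<b}|lebesgue. f s) = (LINT s:{a..b}|lebesgue. f s)"
  by (rule set_integral_discrete_difference[where X = "{a, b}"]) auto

lemma test_function_smooth: "test_function a b \<phi> \<Longrightarrow> smooth \<phi>"
  by (simp add: test_function_def smooth_def)

lemma test_function_ends: "test_function a b \<phi> \<Longrightarrow> \<phi> a = 0 \<and> \<phi> b = 0"
  unfolding test_function_def by fastforce

text \<open>
The chord over the whole interval serves as a competitor with finite action.
\<close>

lemma chord_weak_derivative:
  fixes v :: "real \<Rightarrow> 'v::euclidean_space"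
  assumes "a < b"
  shows "has_weak_derivative a b (chord a b v) (\<lambda>s. slope a b v)"
  unfolding has_weak_derivative_def
proof (intro conjI allI impI)
  show "set_integrable lebesgue {a<..<b} (\<lambda>s. slope a b v)"
    by (rule set_integrable_subset[OF absolutely_integrable_continuous_real[of a b]]) auto
  fix \<phi> assume "test_function a b \<phi>"
  then show "(LINT x:{a<..<b}|lebesgue. deriv \<phi> x *\<^sub>R chord a b v x)
      = - (LINT x:{a<..<b}|lebesgue. \<phi> x *\<^sub>R slope a b v)"
    using chord_by_parts[OF test_function_smooth assms, of a b \<phi> v] test_function_ends[of a b \<phi>]
    by (simp add: set_integral_open_closed)
qed

lemma chord_W11:
  fixes v :: "real \<Rightarrow> 'v::euclidean_space"
  assumes "a < b"
  shows "chord a b v \<in> W11 a b"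
proof -
  have "set_integrable lebesgue {a<..<b} (chord a b v)"
    by (rule set_integrable_subset[OF absolutely_integrable_continuous_real[OF continuous_on_chord, of a b]]) auto
  then show ?thesis
    unfolding W11_def using ac_chord[of a b a b v] chord_weak_derivative[OF assms, of v] by blast
qed

lemma cut_corner_weak_derivative:
  fixes v :: "real \<Rightarrow> 'v::euclidean_space"
  assumes g: "has_weak_derivative a b v g" and v: "continuous_on {a..b} v" and xy: "a < x" "x < y" "y < b"
  shows "has_weak_derivative a b (cut_corner x y v) (\<lambda>s. if s \<in> {x..y} then slope x y v else g s)"
  unfolding has_weak_derivative_def
proof (intro conjI allI impI)
  let ?q = "slope x y v" and ?c = "chord x y v"
  have gi: "set_integrable lebesgue {a<..<b} g" using g by (simp add: has_weak_derivative_def)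
  have vi: "set_integrable lebesgue {a<..<b} v"
    by (rule set_integrable_subset[OF absolutely_integrable_continuous_real[OF v]]) auto
  have split: "(LINT s:{a<..<b}|lebesgue. if s \<in> {x..y} then h s else f s)
     = (LINT s:{a<..<b}|lebesgue. f s) + ((LINT s:{x..y}|lebesgue. h s) - (LINT s:{x..y}|lebesgue. f s))"
    and split_integrable: "set_integrable lebesgue {a<..<b} (\<lambda>s. if s \<in> {x..y} then h s else f s)"
    if f: "set_integrable lebesgue {a<..<b} f" and h: "continuous_on {x..y} h" for f h :: "real \<Rightarrow> 'v"
  proof -
    have fi: "set_integrable lebesgue {x..y} f"
      by (rule set_integrable_subset[OF f]) (use xy in auto)
    have hi: "set_integrable lebesgue {x..y} h"
      by (rule absolutely_integrable_continuous_real[OF h])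
    have eq: "indicator {a<..<b} s *\<^sub>R (if s \<in> {x..y} then h s else f s)
       = indicator {a<..<b} s *\<^sub>R f s + (indicator {x..y} s *\<^sub>R h s - indicator {x..y} s *\<^sub>R f s)" for s
      using xy by (auto simp: indicator_def)
    note i = f[unfolded set_integrable_def] fi[unfolded set_integrable_def] hi[unfolded set_integrable_def]
    show "set_integrable lebesgue {a<..<b} (\<lambda>s. if s \<in> {x..y} then h s else f s)"
      unfolding set_integrable_def eq by (intro Bochner_Integration.integrable_add Bochner_Integration.integrable_diff i)
    show "(LINT s:{a<..<b}|lebesgue. if s \<in> {x..y} then h s else f s)
     = (LINT s:{a<..<b}|lebesgue. f s) + ((LINT s:{x..y}|lebesgue. h s) - (LINT s:{x..y}|lebesgue. f s))"
      unfolding set_lebesgue_integral_def eq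
      by (simp only: Bochner_Integration.integral_add[OF i(1) Bochner_Integration.integrable_diff[OF i(3,2)]] Bochner_Integration.integral_diff[OF i(3,2)])
  qed
  show "set_integrable lebesgue {a<..<b} (\<lambda>s. if s \<in> {x..y} then ?q else g s)"
    by (rule split_integrable[OF gi]) simp
  fix \<phi> assume test: "test_function a b \<phi>"
  then have \<phi>: "smooth \<phi>" by (rule test_function_smooth)
  have \<phi>c: "continuous_on S \<phi>" "continuous_on S (deriv \<phi>)" for S
    by (intro smooth_continuous_on[OF \<phi>] smooth_continuous_on[OF smooth_deriv[OF \<phi>]])+
  have "(LINT s:{a<..<b}|lebesgue. deriv \<phi> s *\<^sub>R cut_corner x y v s)
     = (LINT s:{a<..<b}|lebesgue. if s \<in> {x..y} then deriv \<phi> s *\<^sub>R ?c s else deriv \<phi> s *\<^sub>R v s)"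
    by (rule arg_cong[where f = "set_lebesgue_integral lebesgue {a<..<b}"]) (auto simp: cut_corner_def)
  also have "\<dots> = (LINT s:{a<..<b}|lebesgue. deriv \<phi> s *\<^sub>R v s)
     + ((LINT s:{x..y}|lebesgue. deriv \<phi> s *\<^sub>R ?c s) - (LINT s:{x..y}|lebesgue. deriv \<phi> s *\<^sub>R v s))"
    by (rule split) (intro set_integrable_continuous_scaleR[OF vi] continuous_on_scaleR continuous_on_chord \<phi>c)+
  also have "\<dots> = - (LINT s:{a<..<b}|lebesgue. \<phi> s *\<^sub>R g s)
     - ((LINT s:{x..y}|lebesgue. \<phi> s *\<^sub>R ?q) - (LINT s:{x..y}|lebesgue. \<phi> s *\<^sub>R g s))"
    using g test chord_by_parts[OF \<phi> xy(2), of v] weak_derivative_by_parts[OF g v \<phi> xy]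
    by (simp add: has_weak_derivative_def)
  also have "\<dots> = - (LINT s:{a<..<b}|lebesgue. if s \<in> {x..y} then \<phi> s *\<^sub>R ?q else \<phi> s *\<^sub>R g s)"
    by (subst split) (intro set_integrable_continuous_scaleR[OF gi] continuous_on_scaleR continuous_on_const \<phi>c | simp)+
  also have "(LINT s:{a<..<b}|lebesgue. if s \<in> {x..y} then \<phi> s *\<^sub>R ?q else \<phi> s *\<^sub>R g s)
     = (LINT s:{a<..<b}|lebesgue. \<phi> s *\<^sub>R (if s \<in> {x..y} then ?q else g s))"
    by (rule arg_cong[where f = "set_lebesgue_integral lebesgue {a<..<b}"]) auto
  finally show "(LINT s:{a<..<b}|lebesgue. deriv \<phi> s *\<^sub>R cut_corner x y v s)
     = - (LINT s:{a<..<b}|lebesgue. \<phi> s *\<^sub>R (if s \<in> {x..y} then ?q else g s))" .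
qed

lemma cut_corner_W11:
  fixes v :: "real \<Rightarrow> 'v::euclidean_space"
  assumes v: "v \<in> W11 a b" and xy: "a < x" "x < y" "y < b"
  shows "cut_corner x y v \<in> W11 a b"
proof -
  obtain g where ac: "ac_on_interval a b v" and g: "has_weak_derivative a b v g"
    using v by (auto simp: W11_def)
  have ac': "ac_on_interval a b (cut_corner x y v)"
    using xy by (intro ac_cut_corner ac) auto
  have "set_integrable lebesgue {a<..<b} (cut_corner x y v)"
    by (rule set_integrable_subset[OF absolutely_integrable_continuous_real[OF ac_continuous_on[OF ac']]]) auto
  then show ?thesis
    using cut_corner_weak_derivative[OF g ac_continuous_on[OF ac] xy] ac' by (auto simp: W11_def)
qed

text \<open>
Both weak derivatives have the increments of \<open>u\<close> as their integrals, over every closed subinterval of the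
open interval. Continuity of the integral from below extends this to intervals that touch the end points.
\<close>

lemma weak_derivative_AE_eq:
  fixes u :: "real \<Rightarrow> 'v::euclidean_space"
  assumes u: "continuous_on {a..b} u" and g: "has_weak_derivative a b u g" and h: "has_weak_derivative a b u h"
  shows "AE s in lebesgue. s \<in> {a<..<b} \<longrightarrow> g s = h s"
proof -
  define f where "f s = indicator {a<..<b} s *\<^sub>R g s - indicator {a<..<b} s *\<^sub>R h s" for s
  have gi: "set_integrable lebesgue {a<..<b} g" and hi: "set_integrable lebesgue {a<..<b} h"
    using g h by (auto simp: has_weak_derivative_def)
  have f: "integrable lebesgue f"
    unfolding f_def using gi hi by (intro Bochner_Integration.integrable_diff) (auto simp: set_integrable_def)
  have inside: "(LINT s:{x..y}|lebesgue. f s) = 0" if xy: "a < x" "x < y" "y < b" for x y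
  proof -
    have i: "set_integrable lebesgue {x..y} g" "set_integrable lebesgue {x..y} h"
      by (rule set_integrable_subset[OF gi] set_integrable_subset[OF hi]; use xy in auto)+
    have "(LINT s:{x..y}|lebesgue. f s) = (LINT s:{x..y}|lebesgue. g s - h s)"
      by (rule set_lebesgue_integral_cong) (use xy in \<open>auto simp: f_def\<close>)
    then show ?thesis
      using set_integral_diff(2)[OF i] weak_derivative_integral[OF g u xy] weak_derivative_integral[OF h u xy] by simp
  qed
  have "AE s in lebesgue. f s = 0"
  proof (rule AE_zero_if_interval_integrals_zero[OF f])
    fix x y :: real assume "x < y"
    show "(LINT s:{x..y}|lebesgue. f s) = 0"
    proof (cases "max a x < min b y")
      case False
      have "(LINT s:{x..y}|lebesgue. f s) = (LINT s:{x..y}|lebesgue. (0::'v))"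
        by (rule set_lebesgue_integral_cong) (use False \<open>x < y\<close> in \<open>auto simp: f_def indicator_def\<close>)
      then show ?thesis by simp
    next
      case True
      define p r where "p = max a x" and "r = min b y"
      have pr: "p < r" using True by (simp add: p_def r_def)
      have "(LINT s:{x..y}|lebesgue. f s) = (LINT s:{p<..<r}|lebesgue. f s)"
      proof -
        have "(LINT s:{p..r}|lebesgue. f s) = (LINT s:{x..y}|lebesgue. f s)"
          by (rule set_integral_superset) (auto simp: f_def p_def r_def)
        then show ?thesis by (simp add: set_integral_open_closed)
      qed
      moreover have "(LINT s:{p<..<r}|lebesgue. f s) = 0"
      proof -
        define \<delta> where "\<delta> n = (r - p) / (3 * real (Suc n))" for n :: nat
        define I where "I n = {p + \<delta> n..r - \<delta> n}" for n
        have \<delta>: "\<delta> n > 0" "\<delta> n \<le> (r - p) / 3" for n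
          unfolding \<delta>_def using pr by (simp, intro divide_left_mono) auto
        have "incseq I"
        proof (rule incseq_SucI)
          fix n
          have "\<delta> (Suc n) \<le> \<delta> n" using pr by (auto simp: \<delta>_def intro!: divide_left_mono)
          then show "I n \<subseteq> I (Suc n)" by (auto simp: I_def)
        qed
        moreover have [simp]: "I n \<in> sets lebesgue" for n by (simp add: I_def)
        moreover have "set_integrable lebesgue (\<Union>n. I n) f"
          unfolding set_integrable_def by (intro integrable_mult_indicator f sets.countable_UN) auto
        ultimately have lim: "(\<lambda>n. LINT s:I n|lebesgue. f s) \<longlonglongrightarrow> (LINT s:(\<Union>n. I n)|lebesgue. f s)"
          by (intro set_integral_cont_up)
        have "(LINT s:I n|lebesgue. f s) = 0" for n
          unfolding I_def by (rule inside) (use \<delta>[of n] pr in \<open>auto simp: p_def r_def\<close>)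
        then have "(LINT s:(\<Union>n. I n)|lebesgue. f s) = 0"
          using lim by (simp add: LIMSEQ_const_iff)
        moreover have "(\<Union>n. I n) = {p<..<r}"
        proof (intro equalityI subsetI)
          fix s assume s: "s \<in> {p<..<r}"
          have "\<delta> \<longlonglongrightarrow> 0"
          proof (rule Lim_transform_eventually)
            show "(\<lambda>n. (r - p) / 3 * inverse (real (Suc n))) \<longlonglongrightarrow> 0"
              using tendsto_mult[OF tendsto_const[of "(r - p) / 3"] LIMSEQ_inverse_real_of_nat] by simp
            show "\<forall>\<^sub>F n in sequentially. (r - p) / 3 * inverse (real (Suc n)) = \<delta> n"
              by (intro always_eventually allI) (simp add: \<delta>_def divide_simps)
          qed
          then have "\<forall>\<^sub>F n in sequentially. \<delta> n < min (s - p) (r - s)"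
            using s by (intro order_tendstoD(2)[of _ 0]) auto
          then obtain n where "\<delta> n < min (s - p) (r - s)"
            by (auto simp: eventually_sequentially)
          then show "s \<in> (\<Union>n. I n)" by (auto simp: I_def intro!: exI[of _ n])
        next
          fix s assume "s \<in> (\<Union>n. I n)"
          then obtain n where "s \<in> I n" by blast
          then show "s \<in> {p<..<r}" using \<delta>(1)[of n] by (auto simp: I_def)
        qed
        ultimately show ?thesis by simp
      qed
      ultimately show ?thesis by simp
    qed
  qed
  then show ?thesis by eventually_elim (auto simp: f_def indicator_def split: if_splits)
qed

section \<open>The action of a minimizer\<close>

lemma W11_continuous_on: "v \<in> W11 a b \<Longrightarrow> continuous_on {a..b} v"
  by (auto simp: W11_def ac_continuous_on)

lemma W11_weak_derivative: "v \<in> W11 a b \<Longrightarrow> has_weak_derivative a b v (weak_derivative a b v)"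
  unfolding weak_derivative_def W11_def by (auto intro: someI[of "has_weak_derivative a b v"])

text \<open>
The integrand along \<open>u\<close> for an arbitrary representative \<open>g\<close> of the weak derivative. The end points are left
out because weak derivatives are determined on the open interval only.
\<close>

definition lagrangian :: "real \<Rightarrow> real \<Rightarrow> (real \<Rightarrow> 'v \<Rightarrow> 'v \<Rightarrow> real) \<Rightarrow> (real \<Rightarrow> 'v) \<Rightarrow> (real \<Rightarrow> 'v) \<Rightarrow> real \<Rightarrow> real" where
  "lagrangian a b L u g s = indicator {a<..<b} s * L s (u s) (g s)"

lemma action_lagrangian:
  fixes u g :: "real \<Rightarrow> 'v::euclidean_space"
  assumes u: "u \<in> W11 a b" and g: "has_weak_derivative a b u g"
  shows "action a b L u = enn2ereal (\<integral>\<^sup>+ s. ennreal (lagrangian a b L u g s) \<partial>lebesgue)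
    - enn2ereal (\<integral>\<^sup>+ s. ennreal (- lagrangian a b L u g s) \<partial>lebesgue)"
proof -
  have ends: "AE s in lebesgue. s \<notin> {a, b}"
    by (intro AE_not_in) auto
  note eq = weak_derivative_AE_eq[OF W11_continuous_on[OF u] W11_weak_derivative[OF u] g]
  have "(\<integral>\<^sup>+ s\<in>{a..b}. ennreal (L s (u s) (weak_derivative a b u s)) \<partial>lebesgue)
      = (\<integral>\<^sup>+ s. ennreal (lagrangian a b L u g s) \<partial>lebesgue)"
    by (rule nn_integral_cong_AE) (use ends eq in eventually_elim, auto simp: lagrangian_def indicator_def)
  moreover have "(\<integral>\<^sup>+ s\<in>{a..b}. ennreal (- L s (u s) (weak_derivative a b u s)) \<partial>lebesgue)
      = (\<integral>\<^sup>+ s. ennreal (- lagrangian a b L u g s) \<partial>lebesgue)"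
    by (rule nn_integral_cong_AE) (use ends eq in eventually_elim, auto simp: lagrangian_def indicator_def)
  ultimately show ?thesis unfolding action_def by simp
qed

lemma action_integrable:
  fixes u g :: "real \<Rightarrow> 'v::euclidean_space"
  assumes u: "u \<in> W11 a b" and g: "has_weak_derivative a b u g"
    and int: "integrable lebesgue (lagrangian a b L u g)"
  shows "action a b L u = ereal (LINT s|lebesgue. lagrangian a b L u g s)"
proof -
  let ?F = "lagrangian a b L u g"
  obtain P N where "(\<integral>\<^sup>+ s. ennreal (?F s) \<partial>lebesgue) = ennreal P" "P \<ge> 0"
    "(\<integral>\<^sup>+ s. ennreal (- ?F s) \<partial>lebesgue) = ennreal N" "N \<ge> 0"
    using int unfolding real_integrable_def by (metis ennreal_cases infinity_ennreal_def)
  then show ?thesis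
    unfolding action_lagrangian[OF u g] real_lebesgue_integral_def[OF int] by (simp add: enn2ereal_ennreal)
qed

text \<open>
Continuity of \<open>L\<close> is known only for times in \<open>[a, b]\<close>, so time is first clamped to this interval.
\<close>

lemma lagrangian_measurable:
  fixes L :: "real \<Rightarrow> 'v::euclidean_space \<Rightarrow> 'v \<Rightarrow> real"
  assumes L: "continuous_on ({a..b} \<times> UNIV \<times> UNIV) (\<lambda>(s, y, p). L s y p)" and ab: "a < b"
    and u: "continuous_on {a..b} u" and g: "set_integrable lebesgue {a<..<b} g"
  shows "lagrangian a b L u g \<in> borel_measurable lebesgue"
proof -
  define \<kappa> where "\<kappa> s = max a (min b s)" for s
  define h where "h s = indicat_real {a<..<b} s *\<^sub>R g s" for s
  have \<kappa>: "continuous_on UNIV \<kappa>" "\<kappa> s \<in> {a..b}" for s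
    unfolding \<kappa>_def[abs_def] using ab by (auto intro!: continuous_intros)
  have "continuous_on UNIV (\<lambda>s. u (\<kappa> s))"
    by (rule continuous_on_compose2[OF u \<kappa>(1)]) (use \<kappa>(2) in auto)
  then have [measurable]: "(\<lambda>s. u (\<kappa> s)) \<in> borel_measurable lebesgue"
    by (intro measurable_completion) (auto intro: borel_measurable_continuous_onI)
  have [measurable]: "h \<in> borel_measurable lebesgue"
    using g unfolding h_def[abs_def] set_integrable_def by simp
  have [measurable]: "(\<lambda>s. s) \<in> borel_measurable (lebesgue :: real measure)"
    by (intro measurable_completion) simp
  have "continuous_on UNIV (\<lambda>(s, y, p). L (\<kappa> s) y p)"
  proof -
    have "continuous_on UNIV (\<lambda>z::real \<times> 'v \<times> 'v. (\<kappa> (fst z), fst (snd z), snd (snd z)))"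
      by (intro continuous_on_Pair continuous_on_compose2[OF \<kappa>(1)] continuous_intros) auto
    from continuous_on_compose2[OF L this] show ?thesis
      using \<kappa>(2) by (force simp: case_prod_beta)
  qed
  then have [measurable]: "(\<lambda>(s, y, p). L (\<kappa> s) y p) \<in> borel_measurable borel"
    by (rule borel_measurable_continuous_onI)
  have "(\<lambda>s. (s, u (\<kappa> s), h s)) \<in> borel_measurable lebesgue"
    by (intro borel_measurable_Pair) measurable
  from measurable_compose[OF this, of "\<lambda>(s, y, p). L (\<kappa> s) y p"]
  have [measurable]: "(\<lambda>s. L (\<kappa> s) (u (\<kappa> s)) (h s)) \<in> borel_measurable lebesgue" by simp
  have [measurable]: "indicat_real {a<..<b} \<in> borel_measurable lebesgue"
    by (rule borel_measurable_indicator) simp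
  have "(\<lambda>s. indicat_real {a<..<b} s * L (\<kappa> s) (u (\<kappa> s)) (h s)) \<in> borel_measurable lebesgue"
    by measurable
  also have "(\<lambda>s. indicat_real {a<..<b} s * L (\<kappa> s) (u (\<kappa> s)) (h s)) = lagrangian a b L u g"
    by (auto simp: lagrangian_def \<kappa>_def h_def indicator_def)
  finally show ?thesis .
qed

lemma continuous_on_triple_bounded:
  fixes L :: "real \<Rightarrow> 'v::euclidean_space \<Rightarrow> 'v \<Rightarrow> real"
  assumes L: "continuous_on ({a..b} \<times> UNIV \<times> UNIV) (\<lambda>(s, y, p). L s y p)"
  shows "\<exists>B>0. \<forall>s\<in>{a..b}. \<forall>y p. norm y \<le> \<rho> \<longrightarrow> norm p \<le> \<rho> \<longrightarrow> \<bar>L s y p\<bar> \<le> B"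
proof -
  let ?K = "{a..b} \<times> cball (0::'v) \<rho> \<times> cball (0::'v) \<rho>"
  have "bounded ((\<lambda>(s, y, p). L s y p) ` ?K)"
    by (intro compact_imp_bounded compact_continuous_image continuous_on_subset[OF L] compact_Times) auto
  then obtain B where "B > 0" "\<And>z. z \<in> (\<lambda>(s, y, p). L s y p) ` ?K \<Longrightarrow> norm z \<le> B"
    unfolding bounded_pos by blast
  then show ?thesis by (intro exI[of _ B]) force
qed

lemma continuous_image_norm_bound:
  fixes u :: "real \<Rightarrow> 'v::real_normed_vector"
  assumes "continuous_on {a..b} u"
  shows "\<exists>B>0. \<forall>s\<in>{a..b}. norm (u s) \<le> B"
  using compact_imp_bounded[OF compact_continuous_image[OF assms compact_Icc]]
  unfolding bounded_pos by auto

text \<open>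
The gap at distance \<open>1/R\<close> entails the gap at distance \<open>1\<close>, which keeps the constants simple.
\<close>

lemma condition_SC_unit_gapE:
  fixes L :: "real \<Rightarrow> 'v::euclidean_space \<Rightarrow> 'v \<Rightarrow> real"
  assumes "condition_SC a b L" "R \<ge> 1"
  obtains \<tau> where "\<tau> > 0" "\<And>s y p. s \<in> {a..b} \<Longrightarrow> \<bar>s\<bar> \<le> R + 1 \<Longrightarrow> norm y \<le> R + 1 \<Longrightarrow> norm p \<le> R + 1 \<Longrightarrow>
      \<exists>\<xi>. is_subgradient (L s y) p \<xi> \<and>
        (\<forall>q. norm (q - p) \<ge> 1 \<longrightarrow> L s y q \<ge> L s y p + \<xi> \<bullet> (q - p) + 2 * \<tau>)"
proof -
  obtain \<tau> where \<tau>: "\<tau> > 0" "\<And>s y p. s \<in> {a..b} \<Longrightarrow> Max {\<bar>s\<bar>, norm y, norm p} \<le> R + 1 \<Longrightarrow>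
        (\<exists>\<xi>. is_subgradient (L s y) p \<xi> \<and>
             (\<forall>q. norm (q - p) \<ge> inverse R \<longrightarrow> L s y q \<ge> L s y p + \<xi> \<bullet> (q - p) + 2 * \<tau>))"
    using assms unfolding condition_SC_def by blast
  have R: "inverse R \<le> 1" using assms(2) by (simp add: inverse_le_1_iff)
  show ?thesis
  proof (rule that[OF \<tau>(1)])
    fix s and y p :: 'v assume "s \<in> {a..b}" "\<bar>s\<bar> \<le> R + 1" "norm y \<le> R + 1" "norm p \<le> R + 1"
    then show "\<exists>\<xi>. is_subgradient (L s y) p \<xi> \<and>
        (\<forall>q. norm (q - p) \<ge> 1 \<longrightarrow> L s y q \<ge> L s y p + \<xi> \<bullet> (q - p) + 2 * \<tau>)"
      using \<tau>(2)[of s y p] R by (simp, meson order_trans)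
  qed
qed

lemma condition_SC_subgradient:
  fixes L :: "real \<Rightarrow> 'v::euclidean_space \<Rightarrow> 'v \<Rightarrow> real"
  assumes "condition_SC a b L" "s \<in> {a..b}"
  shows "\<exists>\<xi>. is_subgradient (L s y) p \<xi>"
proof -
  define R where "R = Max {1, \<bar>s\<bar>, norm y, norm p}"
  have "R \<ge> 1" "\<bar>s\<bar> \<le> R + 1" "norm y \<le> R + 1" "norm p \<le> R + 1"
    by (auto simp: R_def max_def)
  then show ?thesis using condition_SC_unit_gapE[OF assms(1)] assms(2) by metis
qed

text \<open>
Subgradients at \<open>p = 0\<close> are bounded on bounded sets: evaluating the subgradient inequality at
the unit vector in direction \<open>\<xi>\<close> bounds the norm of \<open>\<xi>\<close> by values of \<open>L\<close>.
\<close>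

lemma condition_SC_linear_lower_bound:
  fixes L :: "real \<Rightarrow> 'v::euclidean_space \<Rightarrow> 'v \<Rightarrow> real"
  assumes L: "continuous_on ({a..b} \<times> UNIV \<times> UNIV) (\<lambda>(s, y, p). L s y p)" and SC: "condition_SC a b L"
  shows "\<exists>C\<ge>0. \<forall>s\<in>{a..b}. \<forall>y p. norm y \<le> \<rho> \<longrightarrow> L s y p \<ge> - C * (1 + norm p)"
proof -
  obtain B where B: "B > 0" "\<And>s y p. s \<in> {a..b} \<Longrightarrow> norm y \<le> max \<rho> 1 \<Longrightarrow> norm p \<le> max \<rho> 1 \<Longrightarrow> \<bar>L s y p\<bar> \<le> B"
    using continuous_on_triple_bounded[OF L, of "max \<rho> 1"] by blast
  have "L s y p \<ge> - (2 * B) * (1 + norm p)" if s: "s \<in> {a..b}" and y: "norm y \<le> \<rho>" for s y p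
  proof -
    obtain \<xi> where \<xi>: "\<And>q. L s y q \<ge> L s y 0 + \<xi> \<bullet> q"
      using condition_SC_subgradient[OF SC s, of y 0] by (auto simp: is_subgradient_def)
    have B': "\<bar>L s y q\<bar> \<le> B" if "norm q \<le> 1" for q
      using B(2)[OF s, of y q] y that by auto
    have "norm \<xi> \<le> 2 * B"
    proof -
      have "\<xi> \<bullet> sgn \<xi> = norm \<xi>"
        by (simp add: sgn_div_norm dot_square_norm power2_eq_square divide_inverse_commute[symmetric])
      moreover have "norm (sgn \<xi>) \<le> 1" by (simp add: norm_sgn)
      ultimately show ?thesis
        using \<xi>[of "sgn \<xi>"] B'[of "sgn \<xi>"] B'[of 0] by (simp add: abs_le_iff)
    qed
    then have "\<bar>\<xi> \<bullet> p\<bar> \<le> 2 * B * norm p"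
      using Cauchy_Schwarz_ineq2[of \<xi> p] by (meson mult_right_mono norm_ge_zero order_trans)
    moreover have "L s y 0 \<ge> - B" using B'[of 0] by simp
    ultimately show ?thesis using \<xi>[of p] B(1) by (simp add: algebra_simps)
  qed
  then show ?thesis using B(1) by (intro exI[of _ "2 * B"]) auto
qed

text \<open>
The negative part has a finite integral because \<open>L\<close> has a lower bound that is linear in \<open>p\<close>. The positive part
has a finite integral because the action of a minimizer is at most that of the affine function with the same boundary values.
\<close>

lemma minimizer_lagrangian_integrable:
  fixes L :: "real \<Rightarrow> 'v::euclidean_space \<Rightarrow> 'v \<Rightarrow> real"
  assumes L: "continuous_on ({a..b} \<times> UNIV \<times> UNIV) (\<lambda>(s, y, p). L s y p)" and SC: "condition_SC a b L"
    and min: "is_minimizer a b L v" and ab: "a < b" and g: "has_weak_derivative a b v g"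
  shows "integrable lebesgue (lagrangian a b L v g)"
proof -
  let ?F = "lagrangian a b L v g" and ?c = "chord a b v" and ?q = "slope a b v"
  have v: "v \<in> W11 a b" using min by (simp add: is_minimizer_def admissible_def)
  have gi: "set_integrable lebesgue {a<..<b} g" using g by (simp add: has_weak_derivative_def)
  have F: "?F \<in> borel_measurable lebesgue"
    by (rule lagrangian_measurable[OF L ab W11_continuous_on[OF v] gi])
  obtain \<rho> where \<rho>: "\<And>s. s \<in> {a..b} \<Longrightarrow> norm (v s) \<le> \<rho>"
    using continuous_image_norm_bound[OF W11_continuous_on[OF v]] by blast
  obtain C where C: "C \<ge> 0" "\<And>s y p. s \<in> {a..b} \<Longrightarrow> norm y \<le> \<rho> \<Longrightarrow> L s y p \<ge> - C * (1 + norm p)"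
    using condition_SC_linear_lower_bound[OF L SC, of \<rho>] by blast
  have "integrable lebesgue (indicat_real {a<..<b})"
    by (rule integrable_real_indicator) (use less_imp_le[OF ab] in auto)
  then have "integrable lebesgue (\<lambda>s. C * (indicat_real {a<..<b} s + norm (indicat_real {a<..<b} s *\<^sub>R g s)))"
    using gi by (intro integrable_mult_right Bochner_Integration.integrable_add integrable_norm) (auto simp: set_integrable_def)
  then have "(\<integral>\<^sup>+ s. ennreal (C * (indicat_real {a<..<b} s + norm (indicat_real {a<..<b} s *\<^sub>R g s))) \<partial>lebesgue) \<noteq> \<infinity>"
    unfolding real_integrable_def by blast
  moreover have "(\<integral>\<^sup>+ s. ennreal (- ?F s) \<partial>lebesgue)
      \<le> (\<integral>\<^sup>+ s. ennreal (C * (indicat_real {a<..<b} s + norm (indicat_real {a<..<b} s *\<^sub>R g s))) \<partial>lebesgue)"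
  proof (rule nn_integral_mono, rule ennreal_leI)
    fix s
    show "- ?F s \<le> C * (indicat_real {a<..<b} s + norm (indicat_real {a<..<b} s *\<^sub>R g s))"
      using C(2)[of s "v s" "g s"] \<rho>[of s] by (auto simp: lagrangian_def indicator_def)
  qed
  ultimately have neg: "(\<integral>\<^sup>+ s. ennreal (- ?F s) \<partial>lebesgue) \<noteq> \<infinity>"
    by (metis infinity_ennreal_def neq_top_trans)
  have cint: "integrable lebesgue (lagrangian a b L ?c (\<lambda>s. ?q))"
  proof -
    have "continuous_on {a..b} (\<lambda>s. L s (?c s) ?q)"
    proof -
      have "continuous_on {a..b} (\<lambda>s. (s, ?c s, ?q))"
        by (intro continuous_intros continuous_on_chord)
      from continuous_on_compose2[OF L this] show ?thesis by auto
    qed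
    then have "set_integrable lebesgue {a<..<b} (\<lambda>s. L s (?c s) ?q)"
      by (intro set_integrable_subset[OF absolutely_integrable_continuous_real]) auto
    then show ?thesis by (simp add: set_integrable_def lagrangian_def[abs_def])
  qed
  have "?c \<in> admissible a b (v a) (v b)"
    using chord_W11[OF ab, of v] chord_ends[of a b v] ab by (simp add: admissible_def)
  then have "action a b L v \<le> action a b L ?c" using min by (simp add: is_minimizer_def)
  also have "\<dots> < \<infinity>"
    unfolding action_integrable[OF chord_W11[OF ab] chord_weak_derivative[OF ab] cint] by simp
  finally have "action a b L v < \<infinity>" .
  then have "(\<integral>\<^sup>+ s. ennreal (?F s) \<partial>lebesgue) \<noteq> \<infinity>"
    unfolding action_lagrangian[OF v g] by auto
  then show ?thesis using F neg by (simp add: real_integrable_def)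
qed

text \<open>
Outside \<open>[x, y]\<close> the minimizer and the competitor have the same integrand, and the common part of the
action is finite, so it cancels.
\<close>

lemma minimizer_chord_comparison:
  fixes L :: "real \<Rightarrow> 'v::euclidean_space \<Rightarrow> 'v \<Rightarrow> real"
  assumes L: "continuous_on ({a..b} \<times> UNIV \<times> UNIV) (\<lambda>(s, y, p). L s y p)" and SC: "condition_SC a b L"
    and min: "is_minimizer a b L v" and xy: "a < x" "x < y" "y < b" and g: "has_weak_derivative a b v g"
  shows "set_integrable lebesgue {x..y} (\<lambda>s. L s (v s) (g s))"
    and "set_integrable lebesgue {x..y} (\<lambda>s. L s (chord x y v s) (slope x y v))"
    and "(LINT s:{x..y}|lebesgue. L s (v s) (g s)) \<le> (LINT s:{x..y}|lebesgue. L s (chord x y v s) (slope x y v))"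
proof -
  let ?u = "cut_corner x y v" and ?h = "\<lambda>s. if s \<in> {x..y} then slope x y v else g s"
  let ?A = "\<lambda>s. indicat_real {x..y} s *\<^sub>R L s (v s) (g s)"
  let ?B = "\<lambda>s. indicat_real {x..y} s *\<^sub>R L s (chord x y v s) (slope x y v)"
  have ab: "a < b" using xy by simp
  have v: "v \<in> W11 a b" using min by (simp add: is_minimizer_def admissible_def)
  note F = minimizer_lagrangian_integrable[OF L SC min ab g]
  have "set_integrable lebesgue {a<..<b} (\<lambda>s. L s (v s) (g s))"
    using F by (simp add: set_integrable_def lagrangian_def[abs_def])
  then show 1: "set_integrable lebesgue {x..y} (\<lambda>s. L s (v s) (g s))"
    by (rule set_integrable_subset) (use xy in auto)
  have "continuous_on {x..y} (\<lambda>s. L s (chord x y v s) (slope x y v))"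
  proof -
    have "continuous_on {x..y} (\<lambda>s. (s, chord x y v s, slope x y v))"
      by (intro continuous_intros continuous_on_chord)
    moreover have "(\<lambda>s. (s, chord x y v s, slope x y v)) ` {x..y} \<subseteq> {a..b} \<times> UNIV \<times> UNIV"
      using xy by auto
    ultimately show ?thesis using continuous_on_compose2[OF L] by fastforce
  qed
  then show 2: "set_integrable lebesgue {x..y} (\<lambda>s. L s (chord x y v s) (slope x y v))"
    by (rule absolutely_integrable_continuous_real)
  note u = cut_corner_W11[OF v xy]
  note h = cut_corner_weak_derivative[OF g W11_continuous_on[OF v] xy]
  have G: "lagrangian a b L ?u ?h s = lagrangian a b L v g s + (?B s - ?A s)" for s
    using xy by (auto simp: lagrangian_def cut_corner_def indicator_def)
  have AB: "integrable lebesgue ?A" "integrable lebesgue ?B"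
    using 1 2 by (auto simp: set_integrable_def)
  have Gint: "integrable lebesgue (lagrangian a b L ?u ?h)"
    unfolding G[abs_def] by (intro Bochner_Integration.integrable_add Bochner_Integration.integrable_diff F AB)
  have "?u \<in> admissible a b (v a) (v b)"
    using u xy by (simp add: admissible_def cut_corner_def)
  then have "action a b L v \<le> action a b L ?u" using min by (simp add: is_minimizer_def)
  then have "(LINT s|lebesgue. lagrangian a b L v g s) \<le> (LINT s|lebesgue. lagrangian a b L ?u ?h s)"
    unfolding action_integrable[OF v g F] action_integrable[OF u h Gint] by simp
  also have "\<dots> = (LINT s|lebesgue. lagrangian a b L v g s) + ((LINT s|lebesgue. ?B s) - (LINT s|lebesgue. ?A s))"
    unfolding G Bochner_Integration.integral_add[OF F Bochner_Integration.integrable_diff[OF AB(2,1)]]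
      Bochner_Integration.integral_diff[OF AB(2,1)] ..
  finally show "(LINT s:{x..y}|lebesgue. L s (v s) (g s)) \<le> (LINT s:{x..y}|lebesgue. L s (chord x y v s) (slope x y v))"
    by (simp add: set_lebesgue_integral_def)
qed

section \<open>Short chords of a minimizer\<close>

text \<open>
Convexity along the ray from \<open>q\<close> through \<open>p\<close>: the value at \<open>p\<close> lies above the line through the values at \<open>q\<close>
and at the intermediate point, where a subgradient exists.
\<close>

lemma subgradient_ray_bound:
  assumes "is_subgradient f (q + (p - q) /\<^sub>R c) \<eta>" "c \<ge> 1"
  shows "f p \<ge> c * f (q + (p - q) /\<^sub>R c) - (c - 1) * f q"
proof -
  let ?m = "q + (p - q) /\<^sub>R c" and ?w = "\<eta> \<bullet> (p - q)"
  have "p - ?m = (1 - inverse c) *\<^sub>R (p - q)" "q - ?m = (- inverse c) *\<^sub>R (p - q)"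
    by (auto simp: algebra_simps)
  then have "f p \<ge> f ?m + (1 - inverse c) * ?w" "f q \<ge> f ?m - inverse c * ?w"
    using assms(1) unfolding is_subgradient_def by (metis inner_scaleR_right, metis inner_scaleR_right minus_mult_left uminus_add_conv_diff add.commute)
  then have "f p + (c - 1) * f q \<ge> f ?m + (1 - inverse c) * ?w + (c - 1) * (f ?m - inverse c * ?w)"
    using assms(2) by (intro add_mono mult_left_mono) auto
  also have "f ?m + (1 - inverse c) * ?w + (c - 1) * (f ?m - inverse c * ?w) = c * f ?m"
    using assms(2) by (simp add: field_simps)
  finally show ?thesis by simp
qed

text \<open>
Uniform continuity transfers (SC) from \<open>(t, z)\<close> to nearby \<open>(s, y)\<close>, but only for bounded \<open>p\<close>. This covers
\<open>p\<close> at distance at most \<open>1\<close> from \<open>q\<close>, and the gap on the unit sphere around \<open>q\<close> then spreads to all other \<open>p\<close>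
along rays, where it grows linearly. Both the gap \<open>\<tau>\<close> and the neighbourhood \<open>\<delta>\<close> are uniform in \<open>q\<close>.
\<close>

lemma condition_SC_growth_near_point:
  fixes L :: "real \<Rightarrow> 'v::euclidean_space \<Rightarrow> 'v \<Rightarrow> real"
  assumes L: "continuous_on ({a..b} \<times> UNIV \<times> UNIV) (\<lambda>(s, y, p). L s y p)" and SC: "condition_SC a b L"
    and t: "t \<in> {a..b}"
  obtains \<tau> \<delta> where "\<tau> > 0" "\<delta> > 0"
    "\<And>q. norm q \<le> M \<Longrightarrow> \<exists>\<xi>. \<forall>s\<in>{a..b}. \<forall>y. \<bar>s - t\<bar> < \<delta> \<longrightarrow> norm (y - z) < \<delta> \<longrightarrow>
       L s y q \<le> L t z q + \<tau> / 4 \<and>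
       (\<forall>p. L s y p \<ge> L t z q + \<xi> \<bullet> (p - q) + \<tau> * (norm (p - q) - 1) - \<tau> / 4)"
proof -
  define R where "R = Max {1, \<bar>t\<bar>, norm z, M}"
  have R: "R \<ge> 1" "\<bar>t\<bar> \<le> R + 1" "norm z \<le> R + 1" "M \<le> R + 1"
    by (auto simp: R_def max_def)
  obtain \<tau> where \<tau>: "\<tau> > 0" "\<And>s y p. s \<in> {a..b} \<Longrightarrow> \<bar>s\<bar> \<le> R + 1 \<Longrightarrow> norm y \<le> R + 1 \<Longrightarrow> norm p \<le> R + 1 \<Longrightarrow>
      \<exists>\<xi>. is_subgradient (L s y) p \<xi> \<and>
        (\<forall>q. norm (q - p) \<ge> 1 \<longrightarrow> L s y q \<ge> L s y p + \<xi> \<bullet> (q - p) + 2 * \<tau>)"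
    using condition_SC_unit_gapE[OF SC R(1)] by metis
  let ?K = "{a..b} \<times> cball z 1 \<times> cball (0::'v) (M + 1)"
  have "uniformly_continuous_on ?K (\<lambda>(s, y, p). L s y p)"
    by (intro compact_uniformly_continuous continuous_on_subset[OF L] compact_Times) auto
  then obtain d where d: "d > 0" "\<And>w w'. w \<in> ?K \<Longrightarrow> w' \<in> ?K \<Longrightarrow> dist w' w < d \<Longrightarrow>
      dist ((\<lambda>(s, y, p). L s y p) w') ((\<lambda>(s, y, p). L s y p) w) < \<tau> / 4"
    using \<tau>(1) unfolding uniformly_continuous_on_def by (metis divide_pos_pos zero_less_numeral)
  define \<delta> where "\<delta> = min 1 (d / 2)"
  have near: "\<bar>L s y p - L t z p\<bar> < \<tau> / 4"
    if "s \<in> {a..b}" "\<bar>s - t\<bar> < \<delta>" "norm (y - z) < \<delta>" "norm p \<le> M + 1" for s y p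
  proof -
    have "dist (s, y, p) (t, z, p) = sqrt ((dist s t)\<^sup>2 + (dist y z)\<^sup>2)"
      by (simp add: dist_Pair_Pair)
    also have "\<dots> \<le> dist s t + dist y z"
      by (rule sqrt_sum_squares_le_sum) auto
    also have "\<dots> = \<bar>s - t\<bar> + norm (y - z)" by (simp add: dist_norm)
    also have "\<dots> < d" using that by (simp add: \<delta>_def)
    finally have "dist (s, y, p) (t, z, p) < d" .
    moreover have "(s, y, p) \<in> ?K" "(t, z, p) \<in> ?K"
      using that t by (auto simp: \<delta>_def dist_norm norm_minus_commute)
    ultimately show ?thesis using d(2)[of "(t, z, p)" "(s, y, p)"] by (simp add: dist_real_def)
  qed
  show ?thesis
  proof (rule that[of \<tau> \<delta>])
    fix q :: 'v assume q: "norm q \<le> M"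
    then obtain \<xi> where \<xi>: "\<And>p. L t z p \<ge> L t z q + \<xi> \<bullet> (p - q)"
      "\<And>p. norm (p - q) \<ge> 1 \<Longrightarrow> L t z p \<ge> L t z q + \<xi> \<bullet> (p - q) + 2 * \<tau>"
      using \<tau>(2)[OF t R(2,3), of q] R(4) by (auto simp: is_subgradient_def)
    have "L s y q \<le> L t z q + \<tau> / 4 \<and>
       (\<forall>p. L s y p \<ge> L t z q + \<xi> \<bullet> (p - q) + \<tau> * (norm (p - q) - 1) - \<tau> / 4)"
      if s: "s \<in> {a..b}" "\<bar>s - t\<bar> < \<delta>" "norm (y - z) < \<delta>" for s y
    proof (intro conjI allI)
      have nq: "\<bar>L s y q - L t z q\<bar> < \<tau> / 4" using near[OF s, of q] q by simp
      then show "L s y q \<le> L t z q + \<tau> / 4" by linarith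
      fix p
      show "L s y p \<ge> L t z q + \<xi> \<bullet> (p - q) + \<tau> * (norm (p - q) - 1) - \<tau> / 4"
      proof (cases "norm (p - q) \<le> 1")
        case True
        then have "norm p \<le> M + 1" using q norm_triangle_ineq[of q "p - q"] by simp
        then have "\<bar>L s y p - L t z p\<bar> < \<tau> / 4" by (rule near[OF s])
        then have "L s y p \<ge> L t z p - \<tau> / 4" by linarith
        moreover have "\<tau> * (norm (p - q) - 1) \<le> 0"
          using True \<tau>(1) by (simp add: mult_nonneg_nonpos)
        ultimately show ?thesis using \<xi>(1)[of p] by linarith
      next
        case False
        define c where "c = norm (p - q)"
        \<comment> \<open>The point of the unit sphere around \<open>q\<close> on the ray through \<open>p\<close>.\<close>
        define m where "m = q + (p - q) /\<^sub>R c"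
        have c: "c > 1" using False by (simp add: c_def)
        have mq: "m - q = (p - q) /\<^sub>R c" by (simp add: m_def)
        have n1: "norm (m - q) = 1" unfolding mq using c by (simp add: c_def[symmetric])
        then have "norm m \<le> M + 1" using q norm_triangle_ineq[of q "m - q"] by simp
        then have "L s y m \<ge> L t z m - \<tau> / 4" using near[OF s, of m] by linarith
        then have "L s y m \<ge> L t z q + \<xi> \<bullet> (m - q) + 7 / 4 * \<tau>" using \<xi>(2)[of m] n1 by simp
        moreover have "\<xi> \<bullet> (m - q) = (\<xi> \<bullet> (p - q)) / c" unfolding mq by (simp add: divide_inverse_commute)
        ultimately have "c * L s y m \<ge> c * (L t z q + (\<xi> \<bullet> (p - q)) / c + 7 / 4 * \<tau>)"
          using c by (intro mult_left_mono) auto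
        also have "c * (L t z q + (\<xi> \<bullet> (p - q)) / c + 7 / 4 * \<tau>) = c * L t z q + \<xi> \<bullet> (p - q) + 7 / 4 * (c * \<tau>)"
          using c by (simp add: field_simps)
        finally have 1: "c * L s y m \<ge> c * L t z q + \<xi> \<bullet> (p - q) + 7 / 4 * (c * \<tau>)" .
        have 2: "(c - 1) * L s y q \<le> (c - 1) * (L t z q + \<tau> / 4)"
          by (rule mult_left_mono) (use nq c in linarith)+
        obtain \<eta> where "is_subgradient (L s y) m \<eta>" using condition_SC_subgradient[OF SC s(1)] by blast
        then have "L s y p \<ge> c * L s y m - (c - 1) * L s y q"
          unfolding m_def by (rule subgradient_ray_bound) (use c in simp)
        also have "c * L s y m - (c - 1) * L s y q
            \<ge> (c * L t z q + \<xi> \<bullet> (p - q) + 7 / 4 * (c * \<tau>)) - (c - 1) * (L t z q + \<tau> / 4)"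
          by (rule diff_mono[OF 1 2])
        also have "(c * L t z q + \<xi> \<bullet> (p - q) + 7 / 4 * (c * \<tau>)) - (c - 1) * (L t z q + \<tau> / 4)
            = L t z q + \<xi> \<bullet> (p - q) + \<tau> * (c - 1) - \<tau> / 4 + (c * \<tau> / 2 + 3 / 2 * \<tau>)"
          by (simp add: field_simps)
        also have "\<dots> \<ge> L t z q + \<xi> \<bullet> (p - q) + \<tau> * (c - 1) - \<tau> / 4"
        proof -
          have "0 \<le> c * \<tau> / 2 + 3 / 2 * \<tau>" using c \<tau>(1) by (intro add_nonneg_nonneg) auto
          then show ?thesis by (simp only: le_add_same_cancel1)
        qed
        finally show ?thesis unfolding c_def .
      qed
    qed
    then show "\<exists>\<xi>. \<forall>s\<in>{a..b}. \<forall>y. \<bar>s - t\<bar> < \<delta> \<longrightarrow> norm (y - z) < \<delta> \<longrightarrow>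
       L s y q \<le> L t z q + \<tau> / 4 \<and>
       (\<forall>p. L s y p \<ge> L t z q + \<xi> \<bullet> (p - q) + \<tau> * (norm (p - q) - 1) - \<tau> / 4)" by blast
  qed (use \<tau>(1) d(1) in \<open>auto simp: \<delta>_def\<close>)
qed

lemma chord_mem_convex:
  fixes v :: "real \<Rightarrow> 'v::real_vector"
  assumes "convex S" "v x \<in> S" "v y \<in> S" "x < y" "s \<in> {x..y}"
  shows "chord x y v s \<in> S"
proof -
  define \<theta> where "\<theta> = (s - x) / (y - x)"
  have "chord x y v s = (1 - \<theta>) *\<^sub>R v x + \<theta> *\<^sub>R v y"
    by (simp add: chord_def slope_def \<theta>_def divide_inverse algebra_simps)
  moreover have "0 \<le> \<theta>" "\<theta> \<le> 1" using assms(4,5) by (auto simp: \<theta>_def)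
  ultimately show ?thesis using convexD_alt[OF assms(1-3)] by simp
qed

lemma slope_diff_chord:
  fixes v :: "real \<Rightarrow> 'v::real_vector"
  assumes "x < y"
  shows "v t - v x - (t - x) *\<^sub>R slope x y v = v t - chord x y v t"
    and "v y - v t - (y - t) *\<^sub>R slope x y v = - (v t - chord x y v t)"
proof -
  have "(y - t) *\<^sub>R slope x y v = (y - x) *\<^sub>R slope x y v - (t - x) *\<^sub>R slope x y v"
    by (simp add: scaleR_diff_left)
  then have "(y - t) *\<^sub>R slope x y v = (v y - v x) - (t - x) *\<^sub>R slope x y v"
    by (simp only: slope_scaleR[OF assms])
  then show "v y - v t - (y - t) *\<^sub>R slope x y v = - (v t - chord x y v t)"
    by (simp add: chord_def)
qed (simp add: chord_def)

lemma set_integral_const_interval: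
  assumes "x \<le> y"
  shows "set_integrable lebesgue {x..y} (\<lambda>s. k :: 'v::euclidean_space)"
    and "(LINT s:{x..y}|lebesgue. k) = (y - x) *\<^sub>R k"
proof -
  show 1: "set_integrable lebesgue {x..y} (\<lambda>s. k)"
    by (intro absolutely_integrable_continuous_real continuous_on_const)
  show "(LINT s:{x..y}|lebesgue. k) = (y - x) *\<^sub>R k"
    using set_lebesgue_integral_eq_integral(2)[OF 1] assms by simp
qed

text \<open>
The function \<open>v\<close> minus its chord vanishes at both ends of \<open>[x, y]\<close>, so its value at \<open>t\<close> is
bounded by the integral of the norm of its derivative over \<open>[x, t]\<close> and also over \<open>[t, y]\<close>.
\<close>

lemma deviation_le_integral:
  fixes v g :: "real \<Rightarrow> 'v::euclidean_space"
  assumes g: "has_weak_derivative a b v g" and v: "continuous_on {a..b} v"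
    and xy: "a < x" "x < t" "t < y" "y < b"
  shows "2 * norm (v t - chord x y v t) \<le> (LINT s:{x..y}|lebesgue. norm (g s - slope x y v))"
proof -
  let ?q = "slope x y v"
  have gi: "set_integrable lebesgue {a<..<b} g" using g by (simp add: has_weak_derivative_def)
  have d: "set_integrable lebesgue {c..d} (\<lambda>s. g s - ?q)"
    and I: "(LINT s:{c..d}|lebesgue. g s - ?q) = v d - v c - (d - c) *\<^sub>R ?q"
    if cd: "a < c" "c < d" "d < b" for c d
  proof -
    have 1: "set_integrable lebesgue {c..d} g"
      by (rule set_integrable_subset[OF gi]) (use cd in auto)
    note 2 = set_integral_const_interval[of c d ?q]
    show "set_integrable lebesgue {c..d} (\<lambda>s. g s - ?q)"
      using cd by (intro set_integral_diff(1) 1 2) auto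
    show "(LINT s:{c..d}|lebesgue. g s - ?q) = v d - v c - (d - c) *\<^sub>R ?q"
      using set_integral_diff(2)[OF 1 2(1)] weak_derivative_integral[OF g v cd] 2(2) cd by simp
  qed
  have n: "set_integrable lebesgue {c..d} (\<lambda>s. norm (g s - ?q))" if cd: "a < c" "c < d" "d < b" for c d
    using d[OF cd] by (rule set_integrable_norm)
  have le: "norm (v d - v c - (d - c) *\<^sub>R ?q) \<le> (LINT s:{c..d}|lebesgue. norm (g s - ?q))"
    if cd: "a < c" "c < d" "d < b" for c d
    using set_integral_norm_bound[OF d[OF cd]] I[OF cd] by simp
  have "2 * norm (v t - chord x y v t) = norm (v t - v x - (t - x) *\<^sub>R ?q) + norm (v y - v t - (y - t) *\<^sub>R ?q)"
    using xy by (simp only: slope_diff_chord norm_minus_cancel)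
  also have "\<dots> \<le> (LINT s:{x..t}|lebesgue. norm (g s - ?q)) + (LINT s:{t..y}|lebesgue. norm (g s - ?q))"
    by (intro add_mono le) (use xy in auto)
  also have "\<dots> = (LINT s:{x..y}|lebesgue. norm (g s - ?q))"
  proof -
    have "{x..t} \<union> {t<..y} = {x..y}" using xy by auto
    moreover have "(LINT s:{x..t} \<union> {t<..y}|lebesgue. norm (g s - ?q))
       = (LINT s:{x..t}|lebesgue. norm (g s - ?q)) + (LINT s:{t<..y}|lebesgue. norm (g s - ?q))"
      by (rule set_integral_Un) (use xy in \<open>auto intro!: n set_integrable_subset[OF n[of t y]]\<close>)
    moreover have "(LINT s:{t<..y}|lebesgue. norm (g s - ?q)) = (LINT s:{t..y}|lebesgue. norm (g s - ?q))"
      by (rule set_integral_discrete_difference[where X = "{t}"]) auto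
    ultimately show ?thesis by simp
  qed
  finally show ?thesis .
qed

text \<open>
This is the trace that minimality leaves on \<open>v\<close> at \<open>t\<close>. It refers neither to \<open>L\<close> nor to derivatives, and it is
invariant under reflections.
\<close>

definition near_chords :: "(real \<Rightarrow> 'v::real_normed_vector) \<Rightarrow> real \<Rightarrow> bool" where
  "near_chords v t \<longleftrightarrow> (\<forall>M. \<exists>\<delta>>0. \<forall>x y. t - \<delta> < x \<longrightarrow> x < t \<longrightarrow> t < y \<longrightarrow> y < t + \<delta> \<longrightarrow>
     norm (slope x y v) \<le> M \<longrightarrow> norm (v t - chord x y v t) \<le> y - x)"

text \<open>
Integrating the lower bound for \<open>L\<close> along \<open>v\<close> and the upper bound along the chord, the comparison gives
\<open>2 \<tau> N \<le> (3/2) \<tau> (y - x)\<close>, where \<open>N\<close> is the distance of \<open>v t\<close> from the chord. The term with \<open>\<xi>\<close> drops out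
because \<open>slope x y v\<close> is the mean of the derivative.
\<close>

lemma minimizer_near_chords:
  fixes L :: "real \<Rightarrow> 'v::euclidean_space \<Rightarrow> 'v \<Rightarrow> real"
  assumes L: "continuous_on ({a..b} \<times> UNIV \<times> UNIV) (\<lambda>(s, y, p). L s y p)" and SC: "condition_SC a b L"
    and min: "is_minimizer a b L v" and t: "t \<in> {a<..<b}"
  shows "near_chords v t"
  unfolding near_chords_def
proof
  fix M
  have vW: "v \<in> W11 a b" using min by (simp add: is_minimizer_def admissible_def)
  note v = W11_continuous_on[OF vW] and g = W11_weak_derivative[OF vW]
  define g where "g = weak_derivative a b v"
  have g: "has_weak_derivative a b v g" unfolding g_def by (rule g)
  have tab: "t \<in> {a..b}" using t by simp
  obtain \<tau> \<delta> where \<tau>: "\<tau> > 0" and \<delta>: "\<delta> > 0" and growth: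
    "\<And>q. norm q \<le> M \<Longrightarrow> \<exists>\<xi>. \<forall>s\<in>{a..b}. \<forall>y. \<bar>s - t\<bar> < \<delta> \<longrightarrow> norm (y - v t) < \<delta> \<longrightarrow>
       L s y q \<le> L t (v t) q + \<tau> / 4 \<and>
       (\<forall>p. L s y p \<ge> L t (v t) q + \<xi> \<bullet> (p - q) + \<tau> * (norm (p - q) - 1) - \<tau> / 4)"
    using condition_SC_growth_near_point[OF L SC tab, of M "v t"] by blast
  have "continuous (at t within {a..b}) v"
    using v t by (auto simp: continuous_on_eq_continuous_within)
  then obtain d where d: "d > 0" "\<And>s. s \<in> {a..b} \<Longrightarrow> dist s t < d \<Longrightarrow> dist (v s) (v t) < \<delta>"
    using \<delta> unfolding continuous_within_eps_delta by meson
  define e where "e = Min {\<delta>, d, t - a, b - t}"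
  have e: "e > 0" "e \<le> \<delta>" "e \<le> d" "e \<le> t - a" "e \<le> b - t"
    using \<delta> d t by (auto simp: e_def)
  show "\<exists>\<delta>>0. \<forall>x y. t - \<delta> < x \<longrightarrow> x < t \<longrightarrow> t < y \<longrightarrow> y < t + \<delta> \<longrightarrow>
     norm (slope x y v) \<le> M \<longrightarrow> norm (v t - chord x y v t) \<le> y - x"
  proof (intro exI[of _ e] conjI allI impI)
    fix x y assume xt: "t - e < x" "x < t" and ty: "t < y" "y < t + e" and M: "norm (slope x y v) \<le> M"
    define q where "q = slope x y v"
    have xy: "a < x" "x < y" "y < b" using xt ty e by auto
    obtain \<xi> where \<xi>: "\<And>s y. s \<in> {a..b} \<Longrightarrow> \<bar>s - t\<bar> < \<delta> \<Longrightarrow> norm (y - v t) < \<delta> \<Longrightarrow> L s y q \<le> L t (v t) q + \<tau> / 4"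
      "\<And>s y p. s \<in> {a..b} \<Longrightarrow> \<bar>s - t\<bar> < \<delta> \<Longrightarrow> norm (y - v t) < \<delta> \<Longrightarrow>
         L s y p \<ge> L t (v t) q + \<xi> \<bullet> (p - q) + \<tau> * (norm (p - q) - 1) - \<tau> / 4"
      using growth[of q] M unfolding q_def by blast
    have s: "s \<in> {a..b}" "\<bar>s - t\<bar> < \<delta>" "norm (v s - v t) < \<delta>" "norm (chord x y v s - v t) < \<delta>" if "s \<in> {x..y}" for s
    proof -
      have near: "r \<in> {a..b} \<and> \<bar>r - t\<bar> < \<delta> \<and> v r \<in> ball (v t) \<delta>" if "r \<in> {x..y}" for r
      proof -
        have "r \<in> {a..b}" "\<bar>r - t\<bar> < \<delta>" "dist r t < d"
          using that xt ty e xy by (auto simp: dist_real_def)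
        then show ?thesis using d(2)[of r] by (simp add: dist_commute)
      qed
      have "chord x y v s \<in> ball (v t) \<delta>"
        using near[of x] near[of y] xy that by (intro chord_mem_convex) auto
      then show "s \<in> {a..b}" "\<bar>s - t\<bar> < \<delta>" "norm (v s - v t) < \<delta>" "norm (chord x y v s - v t) < \<delta>"
        using near[OF that] by (auto simp: dist_norm norm_minus_commute)
    qed
    note cmp = minimizer_chord_comparison[OF L SC min xy g]
    have gi: "set_integrable lebesgue {x..y} g"
      by (rule set_integrable_subset[of lebesgue "{a<..<b}"]) (use g xy in \<open>auto simp: has_weak_derivative_def\<close>)
    have gq: "set_integrable lebesgue {x..y} (\<lambda>s. g s - q)"
      by (rule set_integral_diff(1)[OF gi set_integral_const_interval(1)]) (use xy in simp)
    have "(LINT s:{x..y}|lebesgue. g s - q) = 0"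
      using set_integral_diff(2)[OF gi set_integral_const_interval(1)[of x y q]] set_integral_const_interval(2)[of x y q]
        weak_derivative_integral[OF g v xy] slope_scaleR[OF xy(2), of v] xy by (simp add: q_def)
    then have \<xi>0: "(LINT s:{x..y}|lebesgue. \<xi> \<bullet> (g s - q)) = 0"
      and \<xi>i: "set_integrable lebesgue {x..y} (\<lambda>s. \<xi> \<bullet> (g s - q))"
      using gq unfolding set_lebesgue_integral_def set_integrable_def
      by (simp_all add: inner_scaleR_right[symmetric] del: inner_scaleR_right)
    define N where "N = norm (v t - chord x y v t)"
    have ni: "set_integrable lebesgue {x..y} (\<lambda>s. norm (g s - q))" using gq by (rule set_integrable_norm)
    have N: "2 * N \<le> (LINT s:{x..y}|lebesgue. norm (g s - q))"
      unfolding N_def q_def by (rule deviation_le_integral[OF g v]) (use xt ty xy in auto)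
    let ?c = "L t (v t) q - 5 / 4 * \<tau>"
    have ci: "set_integrable lebesgue {x..y} (\<lambda>s. ?c)" "(LINT s:{x..y}|lebesgue. ?c) = (y - x) * ?c"
      using set_integral_const_interval[of x y ?c] xy by auto
    have "(y - x) * ?c + 2 * (\<tau> * N) \<le> (y - x) * ?c + \<tau> * (LINT s:{x..y}|lebesgue. norm (g s - q))"
      using mult_left_mono[OF N, of \<tau>] \<tau> by simp
    also have "\<dots> = (LINT s:{x..y}|lebesgue. ?c + \<xi> \<bullet> (g s - q) + \<tau> * norm (g s - q))"
      using set_integral_add[OF set_integral_add(1)[OF ci(1) \<xi>i] set_integrable_mult_right[of \<tau>, OF ni]]
        set_integral_add(2)[OF ci(1) \<xi>i] ci(2) \<xi>0 by simp
    also have "\<dots> \<le> (LINT s:{x..y}|lebesgue. L s (v s) (g s))"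
    proof (rule set_integral_mono)
      show "set_integrable lebesgue {x..y} (\<lambda>s. ?c + \<xi> \<bullet> (g s - q) + \<tau> * norm (g s - q))"
        by (intro set_integral_add ci \<xi>i set_integrable_mult_right ni)
      show "?c + \<xi> \<bullet> (g r - q) + \<tau> * norm (g r - q) \<le> L r (v r) (g r)" if "r \<in> {x..y}" for r
        using \<xi>(2)[OF s(1,2,3)[OF that], of "g r"] by (simp add: algebra_simps)
    qed (rule cmp(1))
    also have "\<dots> \<le> (LINT s:{x..y}|lebesgue. L s (chord x y v s) q)"
      using cmp(3) by (simp add: q_def)
    also have "\<dots> \<le> (LINT s:{x..y}|lebesgue. L t (v t) q + \<tau> / 4)"
    proof (rule set_integral_mono)
      show "set_integrable lebesgue {x..y} (\<lambda>s. L s (chord x y v s) q)"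
        using cmp(2) by (simp add: q_def)
      show "L r (chord x y v r) q \<le> L t (v t) q + \<tau> / 4" if "r \<in> {x..y}" for r
        using \<xi>(1)[OF s(1,2,4)[OF that]] .
    qed (rule set_integral_const_interval, use xy in simp)
    also have "\<dots> = (y - x) * (L t (v t) q + \<tau> / 4)"
      using set_integral_const_interval(2)[of x y "L t (v t) q + \<tau> / 4"] xy by simp
    finally have "(y - x) * ?c + 2 * (\<tau> * N) \<le> (y - x) * (L t (v t) q + \<tau> / 4)" .
    moreover have "(y - x) * (L t (v t) q + \<tau> / 4) = (y - x) * ?c + \<tau> * (3 / 2 * (y - x))"
      by (simp add: field_simps)
    ultimately have "\<tau> * (2 * N) \<le> \<tau> * (3 / 2 * (y - x))" by simp
    then have "2 * N \<le> 3 / 2 * (y - x)" using \<tau> by (simp only: mult_le_cancel_left_pos)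
    also have "\<dots> \<le> 2 * (y - x)" using xy by (intro mult_right_mono) auto
    finally show "norm (v t - chord x y v t) \<le> y - x" unfolding N_def by simp
  qed (fact e(1))
qed

section \<open>One-sided derivatives of functions close to their chords\<close>

lemma near_chords_uminus: "near_chords f t \<Longrightarrow> near_chords (\<lambda>s. - f s) t"
proof -
  have S: "slope x y (\<lambda>s. - f s) = - slope x y f" for x y
    by (simp add: slope_def algebra_simps)
  have C: "norm (- f t - chord x y (\<lambda>s. - f s) t) = norm (f t - chord x y f t)" for x y
  proof -
    have "- f t - chord x y (\<lambda>s. - f s) t = - (f t - chord x y f t)"
      unfolding chord_def S by simp
    then show ?thesis by (simp only: norm_minus_cancel)
  qed
  show "near_chords f t \<Longrightarrow> near_chords (\<lambda>s. - f s) t"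
    unfolding near_chords_def S C by simp
qed

lemma near_chords_reflect:
  assumes "near_chords f t"
  shows "near_chords (\<lambda>s. f (2 * t - s)) t"
  unfolding near_chords_def
proof
  fix M
  obtain \<delta> where \<delta>: "\<delta> > 0" "\<And>x y. t - \<delta> < x \<Longrightarrow> x < t \<Longrightarrow> t < y \<Longrightarrow> y < t + \<delta> \<Longrightarrow>
     norm (slope x y f) \<le> M \<Longrightarrow> norm (f t - chord x y f t) \<le> y - x"
    using assms unfolding near_chords_def by metis
  show "\<exists>\<delta>>0. \<forall>x y. t - \<delta> < x \<longrightarrow> x < t \<longrightarrow> t < y \<longrightarrow> y < t + \<delta> \<longrightarrow>
     norm (slope x y (\<lambda>s. f (2 * t - s))) \<le> M \<longrightarrow>
     norm (f (2 * t - t) - chord x y (\<lambda>s. f (2 * t - s)) t) \<le> y - x"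
  proof (intro exI[of _ \<delta>] conjI allI impI)
    fix x y assume xy: "t - \<delta> < x" "x < t" "t < y" "y < t + \<delta>"
      and M: "norm (slope x y (\<lambda>s. f (2 * t - s))) \<le> M"
    let ?x = "2 * t - y" and ?y = "2 * t - x" and ?S = "slope (2 * t - y) (2 * t - x) f"
    have S: "slope x y (\<lambda>s. f (2 * t - s)) = - ?S"
      by (simp add: slope_def algebra_simps)
    have "?x < ?y" using xy by simp
    from slope_scaleR[OF this, of f] have "f ?y = f ?x + (y - x) *\<^sub>R ?S"
      by (simp add: algebra_simps)
    then have "f (2 * t - t) - chord x y (\<lambda>s. f (2 * t - s)) t = f t - chord ?x ?y f t"
      unfolding chord_def S by (simp add: algebra_simps)
    then show "norm (f (2 * t - t) - chord x y (\<lambda>s. f (2 * t - s)) t) \<le> y - x"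
      using \<delta>(2)[of ?x ?y] xy M unfolding S by simp
  qed (fact \<delta>(1))
qed

text \<open>
The line of slope \<open>q = m + 4\<close> through a point of the graph at \<open>x < t\<close> is more than \<open>4 (t - x)\<close> above the graph at
\<open>t\<close>, since the left difference quotients are below \<open>m\<close>. It meets the steep right part at some \<open>y > t\<close>. As the graph
climbs there at rate at least \<open>q + 3\<close>, the line is also more than \<open>3 (y - t)\<close> above the graph at \<open>t\<close>. Both
bounds together exceed what is allowed for a chord of slope \<open>q\<close>, namely \<open>y - x\<close>. The left derivative may be
\<open>-\<infinity>\<close>, and this needs no separate treatment.
\<close>

lemma left_steep_if_right_steep:
  fixes f :: "real \<Rightarrow> real"
  assumes near: "near_chords f t" and r: "r > 0" and cont: "continuous_on (ball t r) f"
    and right: "has_right_derivative f \<infinity> t" and left: "has_left_derivative f d t"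
  shows "d = \<infinity>"
proof (rule ccontr)
  assume "d \<noteq> \<infinity>"
  then obtain m where "d < ereal m"
    by (metis ereal_infty_less(1) less_PInf_Ex_of_nat)
  then have "\<forall>\<^sub>F s in at_left t. ereal ((f s - f t) / (s - t)) < ereal m"
    using left unfolding has_left_derivative_def by (rule order_tendstoD(2)[rotated])
  then obtain c where c: "c < t" "\<And>s. c < s \<Longrightarrow> s < t \<Longrightarrow> (f s - f t) / (s - t) < m"
    unfolding eventually_at_left_field by auto
  define q where "q = m + 4"
  have "\<forall>\<^sub>F s in at_right t. ereal (q + 3) < ereal ((f s - f t) / (s - t))"
    using right unfolding has_right_derivative_def by (rule order_tendstoD(1)) simp
  then obtain e where e: "e > t" "\<And>s. t < s \<Longrightarrow> s < e \<Longrightarrow> q + 3 < (f s - f t) / (s - t)"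
    unfolding eventually_at_right_field by auto
  obtain \<delta> where \<delta>: "\<delta> > 0" "\<And>x y. t - \<delta> < x \<Longrightarrow> x < t \<Longrightarrow> t < y \<Longrightarrow> y < t + \<delta> \<Longrightarrow>
     \<bar>slope x y f\<bar> \<le> \<bar>q\<bar> \<Longrightarrow> \<bar>f t - chord x y f t\<bar> \<le> y - x"
    using near unfolding near_chords_def by (metis real_norm_def)
  obtain z where z: "t < z" "z < e" "z < t + \<delta>" "z < t + r"
    using dense[of t "min e (min (t + \<delta>) (t + r))"] e(1) \<delta>(1) r by auto
  have right_gap: "f s - f t > (q + 3) * (s - t)" if "t < s" "s < e" for s
    using e(2)[OF that] that by (simp add: field_simps)
  have left_gap: "f t - f s < m * (t - s)" if "c < s" "s < t" for s
    using c(2)[OF that] that by (simp add: field_simps)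
  have "isCont f t"
    using cont r by (simp add: continuous_on_eq_continuous_at)
  then have "isCont (\<lambda>x. f z - f x - q * (z - x)) t" by (intro continuous_intros)
  then have lim: "((\<lambda>x. f z - f x - q * (z - x)) \<longlongrightarrow> f z - f t - q * (z - t)) (at_left t)"
    unfolding isCont_def by (rule filterlim_mono) (auto simp: at_le)
  have "f z - f t - q * (z - t) > 0" using right_gap[of z] z by (simp add: algebra_simps)
  then have "\<forall>\<^sub>F x in at_left t. f z - f x - q * (z - x) > 0"
    by (rule order_tendstoD(1)[OF lim])
  then obtain c' where c': "c' < t" "\<And>x. c' < x \<Longrightarrow> x < t \<Longrightarrow> f z - f x - q * (z - x) > 0"
    unfolding eventually_at_left_field by auto
  \<comment> \<open>The point \<open>z\<close> is fixed before \<open>x\<close>: once \<open>x\<close> is close enough to \<open>t\<close>, the line passes below the graph at \<open>z\<close>.\<close>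
  obtain x where x: "x < t" "c < x" "c' < x" "t - \<delta> < x"
    using dense[of "max c (max c' (t - \<delta>))" t] c(1) c'(1) \<delta>(1) by auto
  \<comment> \<open>The height of the graph above the line of slope \<open>q\<close> through the point at \<open>x\<close>.\<close>
  define G where "G y = f y - f x - q * (y - x)" for y
  have "G t < - 4 * (t - x)"
    using left_gap[OF x(2,1)] by (simp add: G_def q_def algebra_simps)
  then have Gt: "G t < 0" using x(1) by simp
  moreover have "G z > 0" using c'(2)[OF x(3,1)] by (simp add: G_def)
  moreover have "continuous_on {t..z} G"
    unfolding G_def by (intro continuous_intros continuous_on_subset[OF cont]) (use z in \<open>auto simp: dist_real_def\<close>)
  ultimately obtain y where y: "t \<le> y" "y \<le> z" "G y = 0"
    using IVT'[of G t 0 z] z by auto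
  then have "y \<noteq> t" using Gt by auto
  then have ty: "t < y" using y by simp
  have slope: "slope x y f = q"
    using y(3) x(1) ty by (simp add: slope_def G_def field_simps)
  define E where "E = chord x y f t - f t"
  have "\<bar>E\<bar> \<le> y - x"
    using \<delta>(2)[of x y] slope x ty y z by (simp add: E_def abs_minus_commute)
  then have "E \<le> (y - t) + (t - x)" by simp
  moreover have "E > 4 * (t - x)"
    using left_gap[OF x(2,1)] by (simp add: E_def chord_def slope q_def algebra_simps)
  moreover have "E > 3 * (y - t)"
    using right_gap[of y] ty y z by (simp add: E_def chord_def slope G_def algebra_simps)
  moreover have "t - x > 0" "y - t > 0" using x(1) ty by auto
  ultimately show False by (smt (verit))
qed

lemma has_derivative_uminus:
  "has_left_derivative f d t \<Longrightarrow> has_left_derivative (\<lambda>s. - f s) (- d) t"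
  "has_right_derivative f d t \<Longrightarrow> has_right_derivative (\<lambda>s. - f s) (- d) t"
proof -
  have eq: "ereal ((- f s - - f t) / (s - t)) = - ereal ((f s - f t) / (s - t))" for s
    by (simp add: minus_divide_left)
  show "has_left_derivative f d t \<Longrightarrow> has_left_derivative (\<lambda>s. - f s) (- d) t"
    "has_right_derivative f d t \<Longrightarrow> has_right_derivative (\<lambda>s. - f s) (- d) t"
    unfolding has_left_derivative_def has_right_derivative_def eq by (rule tendsto_uminus_ereal, assumption)+
qed

lemma has_derivative_reflect:
  "has_left_derivative f d t \<Longrightarrow> has_right_derivative (\<lambda>s. f (2 * t - s)) (- d) t"
  "has_right_derivative f d t \<Longrightarrow> has_left_derivative (\<lambda>s. f (2 * t - s)) (- d) t"
proof -
  have eq: "ereal ((f (2 * t - s) - f (2 * t - t)) / (s - t)) = - ereal ((f (2 * t - s) - f t) / ((2 * t - s) - t))" for s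
    by (cases "s = t") (auto simp: field_simps)
  have "filterlim (\<lambda>s. 2 * t - s) (at_left t) (at_right t)" "filterlim (\<lambda>s. 2 * t - s) (at_right t) (at_left t)"
    unfolding filterlim_at by (auto intro!: tendsto_eq_intros simp: eventually_at_filter)
  note lim = this[THEN filterlim_compose[rotated]]
  show "has_left_derivative f d t \<Longrightarrow> has_right_derivative (\<lambda>s. f (2 * t - s)) (- d) t"
    "has_right_derivative f d t \<Longrightarrow> has_left_derivative (\<lambda>s. f (2 * t - s)) (- d) t"
    unfolding has_left_derivative_def has_right_derivative_def eq
    by (rule tendsto_uminus_ereal, erule lim)+
qed

lemma one_sided_derivatives_agree:
  fixes f :: "real \<Rightarrow> real"
  assumes near: "near_chords f t" and r: "r > 0" and cont: "continuous_on (ball t r) f"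
    and left: "has_left_derivative f dl t" and right: "has_right_derivative f dr t"
    and infinite: "\<bar>dl\<bar> = \<infinity> \<or> \<bar>dr\<bar> = \<infinity>"
  shows "dl = dr \<and> \<bar>dl\<bar> = \<infinity>"
proof -
  have cont': "continuous_on (ball t r) (\<lambda>s. - f s)" using cont by (intro continuous_intros)
  have "continuous_on (ball t r) (\<lambda>s. f (2 * t - s))"
    by (rule continuous_on_compose2[OF cont]) (auto intro!: continuous_intros simp: dist_real_def)
  note reflected = near_chords_reflect[OF near] this has_derivative_reflect(2)[OF right] has_derivative_reflect(1)[OF left]
  then have cont'': "continuous_on (ball t r) (\<lambda>s. - f (2 * t - s))" by (intro continuous_intros)
  note negated = near_chords_uminus[OF near] cont' has_derivative_uminus(1)[OF left] has_derivative_uminus(2)[OF right]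
  note both = near_chords_uminus[OF reflected(1)] cont'' has_derivative_uminus(1)[OF reflected(3)] has_derivative_uminus(2)[OF reflected(4)]
  consider "dr = \<infinity>" | "dr = - \<infinity>" | "dl = \<infinity>" | "dl = - \<infinity>"
    using infinite by (cases dl; cases dr) auto
  then show ?thesis
  proof cases
    case 1
    then have "dl = \<infinity>" using left_steep_if_right_steep[OF near r cont _ left] right by simp
    then show ?thesis using 1 by simp
  next
    case 2
    then have "- dl = \<infinity>" using left_steep_if_right_steep[OF negated(1) r negated(2) _ negated(3)] negated(4) by simp
    then show ?thesis using 2 by (simp add: ereal_uminus_eq_reorder)
  next
    case 3
    then have "dr = \<infinity>" using left_steep_if_right_steep[OF both(1) r both(2) _ both(3)] both(4) by simp
    then show ?thesis using 3 by simp
  next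
    case 4
    then have "- dr = \<infinity>" using left_steep_if_right_steep[OF reflected(1) r reflected(2) _ reflected(3)] reflected(4) by simp
    then show ?thesis using 4 by (simp add: ereal_uminus_eq_reorder)
  qed
qed

lemma slope_component: "slope x y v $ j = slope x y (\<lambda>s. v s $ j)"
  for v :: "real \<Rightarrow> real ^ 'n"
  by (simp add: slope_def)

text \<open>
The other components add at most their Lipschitz constants to the norm of the slope, so a bound for the slope of
component \<open>i\<close> bounds the slope of the whole curve.
\<close>

lemma near_chords_component:
  fixes v :: "real \<Rightarrow> real ^ 'n"
  assumes near: "near_chords v t"
    and lip: "\<And>j. j \<noteq> i \<Longrightarrow> \<exists>r>0. \<exists>C. C-lipschitz_on (ball t r) (\<lambda>s. v s $ j)"
  shows "near_chords (\<lambda>s. v s $ i) t"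
  unfolding near_chords_def
proof
  fix M
  have "\<exists>r>0. \<exists>C\<ge>0. j \<noteq> i \<longrightarrow> C-lipschitz_on (ball t r) (\<lambda>s. v s $ j)" for j
    using lip[of j] lipschitz_on_nonneg zero_less_one order_refl by (cases "j = i") blast+
  then obtain r C where r: "\<And>j. r j > 0" and C: "\<And>j. C j \<ge> 0"
    and lip': "\<And>j. j \<noteq> i \<Longrightarrow> (C j)-lipschitz_on (ball t (r j)) (\<lambda>s. v s $ j)"
    by metis
  define \<rho> where "\<rho> = Min (range r)"
  have \<rho>: "\<rho> > 0" "\<And>j. \<rho> \<le> r j" using r by (auto simp: \<rho>_def)
  obtain \<delta> where \<delta>: "\<delta> > 0" "\<And>x y. t - \<delta> < x \<Longrightarrow> x < t \<Longrightarrow> t < y \<Longrightarrow> y < t + \<delta> \<Longrightarrow>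
     norm (slope x y v) \<le> \<bar>M\<bar> + sum C UNIV \<Longrightarrow> norm (v t - chord x y v t) \<le> y - x"
    using near unfolding near_chords_def by metis
  show "\<exists>\<delta>>0. \<forall>x y. t - \<delta> < x \<longrightarrow> x < t \<longrightarrow> t < y \<longrightarrow> y < t + \<delta> \<longrightarrow>
     norm (slope x y (\<lambda>s. v s $ i)) \<le> M \<longrightarrow> norm (v t $ i - chord x y (\<lambda>s. v s $ i) t) \<le> y - x"
  proof (intro exI[of _ "min \<delta> \<rho>"] conjI allI impI)
    fix x y assume xy: "t - min \<delta> \<rho> < x" "x < t" "t < y" "y < t + min \<delta> \<rho>"
      and M: "norm (slope x y (\<lambda>s. v s $ i)) \<le> M"
    have other: "\<bar>slope x y v $ j\<bar> \<le> C j" if "j \<noteq> i" for j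
    proof -
      have "x \<in> ball t (r j)" "y \<in> ball t (r j)"
        using xy \<rho>(2)[of j] by (auto simp: dist_real_def)
      from lipschitz_onD[OF lip'[OF that] this(2,1)] have "\<bar>v y $ j - v x $ j\<bar> \<le> C j * (y - x)"
        using xy by (simp add: dist_real_def)
      moreover have "\<bar>slope x y v $ j\<bar> = \<bar>v y $ j - v x $ j\<bar> / (y - x)"
        using xy by (simp add: slope_def abs_mult divide_inverse mult.commute)
      ultimately show ?thesis using xy by (simp add: pos_divide_le_eq)
    qed
    have "norm (slope x y v) \<le> (\<Sum>j\<in>UNIV. \<bar>slope x y v $ j\<bar>)" by (rule norm_le_l1_cart)
    also have "\<dots> = \<bar>slope x y v $ i\<bar> + (\<Sum>j\<in>UNIV - {i}. \<bar>slope x y v $ j\<bar>)"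
      by (simp add: sum.remove)
    also have "\<dots> \<le> \<bar>M\<bar> + (\<Sum>j\<in>UNIV - {i}. C j)"
      using M other by (intro add_mono sum_mono) (auto simp: slope_component)
    also have "(\<Sum>j\<in>UNIV - {i}. C j) \<le> sum C UNIV"
      by (rule sum_mono2) (auto simp: C)
    finally have "norm (v t - chord x y v t) \<le> y - x"
      using \<delta>(2)[of x y] xy by simp
    moreover have "(v t - chord x y v t) $ i = v t $ i - chord x y (\<lambda>s. v s $ i) t"
      by (simp add: chord_def slope_component)
    ultimately show "norm (v t $ i - chord x y (\<lambda>s. v s $ i) t) \<le> y - x"
      using component_le_norm_cart[of "v t - chord x y v t" i] by simp
  qed (use \<delta> \<rho> in auto)
qed

theorem corollary29:
  fixes a b t :: real
    and L :: "real \<Rightarrow> real ^ 'n \<Rightarrow> real ^ 'n \<Rightarrow> real"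
    and v :: "real \<Rightarrow> real ^ 'n"
    and i :: 'n
    and dl dr :: "ereal ^ 'n"
  assumes "continuous_on ({a..b} \<times> UNIV \<times> UNIV) (\<lambda>(s, y, p). L s y p)"
    and "condition_SC a b L"
    and "is_minimizer a b L v"
    and "t \<in> {a<..<b}"
    and "has_left_derivative_vec v dl t"
    and "has_right_derivative_vec v dr t"
    and "\<And>j. j \<noteq> i \<Longrightarrow> \<exists>r>0. \<exists>C. C-lipschitz_on (ball t r) (\<lambda>s. v s $ j)"
    and "\<bar>dl $ i\<bar> = \<infinity> \<or> \<bar>dr $ i\<bar> = \<infinity>"
  shows "dl $ i = dr $ i \<and> \<bar>dl $ i\<bar> = \<infinity>"
proof (rule one_sided_derivatives_agree)
  have "near_chords v t"
    by (rule minimizer_near_chords[OF assms(1-4)])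
  then show "near_chords (\<lambda>s. v s $ i) t"
    by (rule near_chords_component) (fact assms(7))
  have "v \<in> W11 a b" using assms(3) by (simp add: is_minimizer_def admissible_def)
  then have "continuous_on {a..b} (\<lambda>s. v s $ i)"
    by (intro continuous_on_component W11_continuous_on)
  then show "continuous_on (ball t (min (t - a) (b - t))) (\<lambda>s. v s $ i)"
    by (rule continuous_on_subset) (auto simp: dist_real_def)
  show "min (t - a) (b - t) > 0" using assms(4) by simp
  show "has_left_derivative (\<lambda>s. v s $ i) (dl $ i) t" "has_right_derivative (\<lambda>s. v s $ i) (dr $ i) t"
    using assms(5,6) by (auto simp: has_left_derivative_vec_def has_right_derivative_vec_def)
qed (fact assms(8))

end
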